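(* Let $n\ge 2$, let $X_1,\dots,X_n$ be real Hilbert spaces and $\mathbf{X}=X_1\times\cdots\times X_n$. Let $A_i\colon X_i\to X_i'$ ($i=1,\dots,n$) be bounded, self-adjoint, positive semi-definite linear operators and $B_i\colon X_i\to X_{i+1}'$ ($i=1,\dots,n-1$) bounded linear operators. Assume that the Schur complements $S_1=A_1$, $S_{i+1}=A_{i+1}+B_iS_i^{-1}B_i'$ ($i=1,\dots,n-1$) are well-defined and positive definite, i.e. there are constants $\sigma_i>0$ with $\langle S_ix_i,x_i\rangle\ge\sigma_i\|x_i\|_{X_i}^2$ for all $x_i\in X_i$, $i=1,\dots,n$. Let $\mathcal{A}\colon\mathbf{X}\to\mathbf{X}'$ be the block tridiagonal operator with diagonal blocks $(-1)^{i-1}A_i$, subdiagonal blocks $B_i$ (in position $(i+1,i)$) and superdiagonal blocks $B_i'$ (in position $(i,i+1)$), let $\mathcal{S}=\operatorname{diag}(S_1,\dots,S_n)$ and $\mathcal{M}=\mathcal{S}^{-1}\mathcal{A}\colon\mathbf{X}\to\mathbf{X}$. Then $\mathcal{A}$ is an isomorphism from $\mathbf{X}$ to $\mathbf{X}'$, $\mathcal{M}$ is an isomorphism from $\mathbf{X}$ to $\mathbf{X}$, and $$\kappa(\mathcal{A})=\kappa(\mathcal{M})\le\frac{\cos\left(\frac{\pi}{2n+1}\right)}{\sin\left(\frac{\pi}{2(2n+1)}\right)}.$$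
   Context: $X'$ is the dual of $X$ and $\langle\cdot,\cdot\rangle$ the duality product. For a bounded operator $B\colon X\to Y'$, the adjoint $B'\colon Y\to X'$ is given by $\langle B'y,x\rangle=\langle Bx,y\rangle$ for all $x\in X,\ y\in Y$. $A_i$ is self-adjoint and positive semi-definite if $\langle A_iy_i,x_i\rangle=\langle A_ix_i,y_i\rangle$ and $\langle A_ix_i,x_i\rangle\ge0$ for all $x_i,y_i\in X_i$. The space $\mathbf{X}$ is equipped with the norm $\|\cdot\|_{\mathcal{S}}$ induced by the inner product $(\mathbf{x},\mathbf{y})_{\mathcal{S}}=\langle\mathcal{S}\mathbf{x},\mathbf{y}\rangle=\sum_{i=1}^n\langle S_ix_i,y_i\rangle$, and $\mathbf{X}'$ with the associated dual norm. $\mathcal{L}(X,Y)$ denotes bounded linear operators with the operator norm. The condition numbers are $\kappa(\mathcal{A})=\|\mathcal{A}\|_{\mathcal{L}(\mathbf{X},\mathbf{X}')}\|\mathcal{A}^{-1}\|_{\mathcal{L}(\mathbf{X}',\mathbf{X})}$ and $\kappa(\mathcal{M})=\|\mathcal{M}\|_{\mathcal{L}(\mathbf{X},\mathbf{X})}\|\mathcal{M}^{-1}\|_{\mathcal{L}(\mathbf{X},\mathbf{X})}$. *)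

theory Defs
  imports "HOL-Analysis.Analysis" "HOL-Library.Function_Algebras"
begin

text \<open>
  Functions into a real vector space form a real vector space pointwise. This covers both
  the tuples \<open>nat \<Rightarrow> 'a\<close> that make up the product space and the functionals \<open>'v \<Rightarrow> real\<close>
  that make up a dual space.
\<close>

instantiation "fun" :: (type, real_vector) real_vector
begin

definition scaleR_fun :: "real \<Rightarrow> ('a \<Rightarrow> 'b) \<Rightarrow> 'a \<Rightarrow> 'b"
  where "scaleR_fun c f = (\<lambda>x. c *\<^sub>R f x)"

instance
  by standard (simp_all add: scaleR_fun_def fun_eq_iff scaleR_add_right scaleR_add_left)

end

text \<open>
  A normed space is given by a carrier \<open>V\<close> (a linear subspace of a real vector space) and a norm
  function \<open>N\<close> on it. All notions depend on the maps only through their values on the carrier.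
\<close>

definition bounded_linear_on ::
  "'v::real_vector set \<Rightarrow> ('v \<Rightarrow> real) \<Rightarrow> 'w::real_vector set \<Rightarrow> ('w \<Rightarrow> real) \<Rightarrow> ('v \<Rightarrow> 'w) \<Rightarrow> bool"
  where "bounded_linear_on V N W M T \<longleftrightarrow>
    (\<forall>x\<in>V. T x \<in> W) \<and>
    (\<forall>x\<in>V. \<forall>y\<in>V. T (x + y) = T x + T y) \<and>
    (\<forall>c. \<forall>x\<in>V. T (c *\<^sub>R x) = c *\<^sub>R T x) \<and>
    (\<exists>C. \<forall>x\<in>V. M (T x) \<le> C * N x)"

text \<open>
  The same formula as for the library's \<^const>\<open>onorm\<close>; elements with \<open>N x = 0\<close> contribute
  \<open>M (T x) / 0 = 0\<close>, so the operator norm on the zero space is \<open>0\<close>.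
\<close>

definition op_norm :: "'v set \<Rightarrow> ('v \<Rightarrow> real) \<Rightarrow> ('w \<Rightarrow> real) \<Rightarrow> ('v \<Rightarrow> 'w) \<Rightarrow> real"
  where "op_norm V N M T = (SUP x\<in>V. M (T x) / N x)"

text \<open>
  Functionals are normalised to vanish off the carrier, so that each functional on \<open>V\<close>
  is represented by exactly one element of \<open>dual V N\<close> and \<open>dual V N\<close> is closed under pointwise
  addition and scaling. The duality product of \<open>f \<in> dual V N\<close> and \<open>x \<in> V\<close> is \<open>f x\<close>.
\<close>

definition dual :: "'v::real_vector set \<Rightarrow> ('v \<Rightarrow> real) \<Rightarrow> ('v \<Rightarrow> real) set"
  where "dual V N = {f. bounded_linear_on V N UNIV abs f \<and> (\<forall>x. x \<notin> V \<longrightarrow> f x = 0)}"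

definition dual_norm :: "'v set \<Rightarrow> ('v \<Rightarrow> real) \<Rightarrow> ('v \<Rightarrow> real) \<Rightarrow> real"
  where "dual_norm V N f = op_norm V N abs f"

definition isomorphism_on ::
  "'v::real_vector set \<Rightarrow> ('v \<Rightarrow> real) \<Rightarrow> 'w::real_vector set \<Rightarrow> ('w \<Rightarrow> real) \<Rightarrow> ('v \<Rightarrow> 'w) \<Rightarrow> bool"
  where "isomorphism_on V N W M T \<longleftrightarrow>
    bounded_linear_on V N W M T \<and> bij_betw T V W \<and> bounded_linear_on W M V N (inv_into V T)"

definition condition_number ::
  "'v set \<Rightarrow> ('v \<Rightarrow> real) \<Rightarrow> 'w set \<Rightarrow> ('w \<Rightarrow> real) \<Rightarrow> ('v \<Rightarrow> 'w) \<Rightarrow> real"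
  where "condition_number V N W M T = op_norm V N M T * op_norm W M N (inv_into V T)"

definition self_adjoint_on :: "'v set \<Rightarrow> ('v \<Rightarrow> 'v \<Rightarrow> real) \<Rightarrow> bool"
  where "self_adjoint_on V T \<longleftrightarrow> (\<forall>x\<in>V. \<forall>y\<in>V. T y x = T x y)"

definition pos_semidef_on :: "'v set \<Rightarrow> ('v \<Rightarrow> 'v \<Rightarrow> real) \<Rightarrow> bool"
  where "pos_semidef_on V T \<longleftrightarrow> (\<forall>x\<in>V. 0 \<le> T x x)"

text \<open>Positive definiteness is meant uniformly, that is, as coercivity.\<close>

definition pos_def_on :: "'v set \<Rightarrow> ('v \<Rightarrow> real) \<Rightarrow> ('v \<Rightarrow> 'v \<Rightarrow> real) \<Rightarrow> bool"
  where "pos_def_on V N T \<longleftrightarrow> (\<exists>\<sigma>>0. \<forall>x\<in>V. \<sigma> * (N x)\<^sup>2 \<le> T x x)"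

text \<open>For \<open>B\<close> from \<open>V\<close> to the dual of \<open>W\<close>, the adjoint maps \<open>W\<close> to the dual of \<open>V\<close>.\<close>

definition adj :: "'v set \<Rightarrow> ('v \<Rightarrow> 'w \<Rightarrow> real) \<Rightarrow> 'w \<Rightarrow> 'v \<Rightarrow> real"
  where "adj V B y = (\<lambda>x. if x \<in> V then B x y else 0)"

text \<open>
  The spaces \<open>X 1, \<dots>, X n\<close> are subspaces of one common vector space. This is no
  restriction, as finitely many Hilbert spaces embed isometrically into their direct sum; they
  may be different, equal or overlapping. If \<open>S\<^sub>1, \<dots>, S\<^sub>i\<close> are positive definite
  (coercive), each of them is a bijection from \<open>X i\<close> onto its dual (Lax-Milgram), so the inverse
  below is then the genuine one and \<open>S\<^sub>i\<^sub>+\<^sub>1\<close> is well-defined. Index 0 is not used.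
\<close>

fun schur ::
  "(nat \<Rightarrow> 'a::real_vector set) \<Rightarrow> (nat \<Rightarrow> 'a \<Rightarrow> 'a \<Rightarrow> real) \<Rightarrow> (nat \<Rightarrow> 'a \<Rightarrow> 'a \<Rightarrow> real) \<Rightarrow>
    nat \<Rightarrow> 'a \<Rightarrow> 'a \<Rightarrow> real"
  where
    "schur X A B 0 = 0"
  | "schur X A B (Suc 0) = A 1"
  | "schur X A B (Suc (Suc i)) = (\<lambda>y. A (Suc (Suc i)) y +
       B (Suc i) (inv_into (X (Suc i)) (schur X A B (Suc i)) (adj (X (Suc i)) (B (Suc i)) y)))"

text \<open>Tuples are normalised to vanish at the indices outside \<open>{1..n}\<close>.\<close>

definition product_space :: "nat \<Rightarrow> (nat \<Rightarrow> 'a::real_vector set) \<Rightarrow> (nat \<Rightarrow> 'a) set"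
  where "product_space n X = {x. (\<forall>i\<in>{1..n}. x i \<in> X i) \<and> (\<forall>i. i \<notin> {1..n} \<longrightarrow> x i = 0)}"

text \<open>
  The operator with block \<open>T i j\<close>, from \<open>X j\<close> to the dual of \<open>X i\<close>, in row \<open>i\<close> and column \<open>j\<close>.
\<close>

definition block_op ::
  "nat \<Rightarrow> (nat \<Rightarrow> 'a::real_vector set) \<Rightarrow> (nat \<Rightarrow> nat \<Rightarrow> 'a \<Rightarrow> 'a \<Rightarrow> real) \<Rightarrow>
    (nat \<Rightarrow> 'a) \<Rightarrow> (nat \<Rightarrow> 'a) \<Rightarrow> real"
  where "block_op n X T x = (\<lambda>y. if y \<in> product_space n X
    then \<Sum>i=1..n. \<Sum>j=1..n. T i j (x j) (y i) else 0)"

definition tridiag_op ::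
  "nat \<Rightarrow> (nat \<Rightarrow> 'a::real_vector set) \<Rightarrow> (nat \<Rightarrow> 'a \<Rightarrow> 'a \<Rightarrow> real) \<Rightarrow> (nat \<Rightarrow> 'a \<Rightarrow> 'a \<Rightarrow> real) \<Rightarrow>
    (nat \<Rightarrow> 'a) \<Rightarrow> (nat \<Rightarrow> 'a) \<Rightarrow> real"
  where "tridiag_op n X A B = block_op n X (\<lambda>i j.
    if i = j then (-1) ^ (i - 1) *\<^sub>R A i
    else if i = j + 1 then B j
    else if j = i + 1 then adj (X i) (B i)
    else 0)"

definition schur_op ::
  "nat \<Rightarrow> (nat \<Rightarrow> 'a::real_vector set) \<Rightarrow> (nat \<Rightarrow> 'a \<Rightarrow> 'a \<Rightarrow> real) \<Rightarrow> (nat \<Rightarrow> 'a \<Rightarrow> 'a \<Rightarrow> real) \<Rightarrow>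
    (nat \<Rightarrow> 'a) \<Rightarrow> (nat \<Rightarrow> 'a) \<Rightarrow> real"
  where "schur_op n X A B = block_op n X (\<lambda>i j. if i = j then schur X A B i else 0)"

definition schur_norm ::
  "nat \<Rightarrow> (nat \<Rightarrow> 'a::real_vector set) \<Rightarrow> (nat \<Rightarrow> 'a \<Rightarrow> 'a \<Rightarrow> real) \<Rightarrow> (nat \<Rightarrow> 'a \<Rightarrow> 'a \<Rightarrow> real) \<Rightarrow>
    (nat \<Rightarrow> 'a) \<Rightarrow> real"
  where "schur_norm n X A B x = sqrt (schur_op n X A B x x)"

definition precond_op ::
  "nat \<Rightarrow> (nat \<Rightarrow> 'a::real_vector set) \<Rightarrow> (nat \<Rightarrow> 'a \<Rightarrow> 'a \<Rightarrow> real) \<Rightarrow> (nat \<Rightarrow> 'a \<Rightarrow> 'a \<Rightarrow> real) \<Rightarrow>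
    (nat \<Rightarrow> 'a) \<Rightarrow> nat \<Rightarrow> 'a"
  where "precond_op n X A B =
    inv_into (product_space n X) (schur_op n X A B) \<circ> tridiag_op n X A B"

end

theory Submission
  imports Defs
begin

text \<open>
  Measured in the inner products given by \<open>S\<^sub>i\<close>, the preconditioned operator factors as
  \<open>M = L D L\<^sup>*\<close>, where \<open>D = diag(1, -1, 1, \<dots>)\<close> and \<open>L\<close> is unit lower bidiagonal with off-diagonal
  blocks \<open>\<plusminus> S\<^sub>i\<^sub>+\<^sub>1\<^sup>-\<^sup>1 B\<^sub>i\<close>, which are contractions because \<open>A\<^sub>i\<^sub>+\<^sub>1 \<ge> 0\<close>. In particular \<open>M\<close> is onto.
  Put \<open>\<theta> = \<pi> / (2n + 1)\<close>. Eliminating blocks one after the other bounds the quadratic form of \<open>M\<close> by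
  \<open>2 cos \<theta>\<close>, and that of its inverse, \<open>\<Sum>\<^sub>i \<plusminus> \<parallel>z\<^sub>i\<parallel>\<^sup>2\<close> with \<open>z = L\<^sup>-\<^sup>1 f\<close>, by \<open>1 / (2 sin (\<theta>/2))\<close>. In both
  cases the pivots satisfy a scalar Riccati recursion that is solved by trigonometric functions and
  stays nonnegative for exactly \<open>n\<close> steps.
\<close>

subsection \<open>Symmetric operators on a Hilbert space\<close>

text \<open>The Riesz property \<open>riesz\<close> stands in for completeness: it is the only
  consequence of completeness used later. Together with \<open>off\<close> it makes
  \<open>s u\<close> equal, as a function, to an element of \<open>dual\<close>.\<close>

locale hilbert_form =
  fixes V :: "'v::real_vector set" and s :: "'v \<Rightarrow> 'v \<Rightarrow> real"
  assumes subspace: "subspace V"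
    and add_left: "x \<in> V \<Longrightarrow> y \<in> V \<Longrightarrow> z \<in> V \<Longrightarrow> s (x + y) z = s x z + s y z"
    and scale_left: "x \<in> V \<Longrightarrow> z \<in> V \<Longrightarrow> s (c *\<^sub>R x) z = c * s x z"
    and sym: "x \<in> V \<Longrightarrow> y \<in> V \<Longrightarrow> s x y = s y x"
    and pos: "x \<in> V \<Longrightarrow> x \<noteq> 0 \<Longrightarrow> 0 < s x x"
    and off: "x \<in> V \<Longrightarrow> y \<notin> V \<Longrightarrow> s x y = 0"
    and riesz: "f \<in> dual V (\<lambda>x. sqrt (s x x)) \<Longrightarrow> \<exists>u\<in>V. s u = f"
begin

abbreviation nrm :: "'v \<Rightarrow> real" where "nrm x \<equiv> sqrt (s x x)"

lemma mem [simp, intro]: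
  "0 \<in> V" "x \<in> V \<Longrightarrow> c *\<^sub>R x \<in> V" "x \<in> V \<Longrightarrow> y \<in> V \<Longrightarrow> x + y \<in> V"
  "x \<in> V \<Longrightarrow> y \<in> V \<Longrightarrow> x - y \<in> V"
  using subspace by (auto intro: subspace_0 subspace_scale subspace_add subspace_diff)

lemma diff_left: "x \<in> V \<Longrightarrow> y \<in> V \<Longrightarrow> z \<in> V \<Longrightarrow> s (x - y) z = s x z - s y z"
  using add_left[of x "(-1) *\<^sub>R y" z] scale_left[of y z "-1"] mem(2)[of y "-1"] by simp

lemma add_right: "x \<in> V \<Longrightarrow> y \<in> V \<Longrightarrow> z \<in> V \<Longrightarrow> s z (x + y) = s z x + s z y"
  using add_left sym mem by metis

lemma diff_right: "x \<in> V \<Longrightarrow> y \<in> V \<Longrightarrow> z \<in> V \<Longrightarrow> s z (x - y) = s z x - s z y"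
  using diff_left sym mem by metis

lemma scale_right: "x \<in> V \<Longrightarrow> z \<in> V \<Longrightarrow> s z (c *\<^sub>R x) = c * s z x"
  using scale_left sym mem by metis

lemmas form_simps = add_left diff_left scale_left add_right diff_right scale_right

lemma zero [simp]: "x \<in> V \<Longrightarrow> s 0 x = 0" "x \<in> V \<Longrightarrow> s x 0 = 0"
  using scale_left[of x x 0] scale_right[of x x 0] by auto

lemma minus [simp]:
  "x \<in> V \<Longrightarrow> - x \<in> V" "x \<in> V \<Longrightarrow> z \<in> V \<Longrightarrow> s (- x) z = - s x z"
  "x \<in> V \<Longrightarrow> z \<in> V \<Longrightarrow> s z (- x) = - s z x"
  using mem(2)[of x "-1"] scale_left[of x z "-1"] scale_right[of x z "-1"] by auto

lemma nonneg: "x \<in> V \<Longrightarrow> 0 \<le> s x x"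
  using pos[of x] by (cases "x = 0") auto

lemma eq_zero_iff: "x \<in> V \<Longrightarrow> s x x = 0 \<longleftrightarrow> x = 0"
  using pos[of x] by (cases "x = 0") auto

text \<open>Expand the squares of \<open>e *\<^sub>R x - y\<close> and
  \<open>e *\<^sub>R x + y\<close> and divide by \<open>e\<close>. The free weight \<open>e\<close>
  is where the pivots enter later.\<close>

lemma young:
  assumes "x \<in> V" "y \<in> V" "e > 0"
  shows "2 * s x y \<le> e * s x x + s y y / e" "- 2 * s x y \<le> e * s x x + s y y / e"
proof -
  have "0 \<le> s (e *\<^sub>R x - y) (e *\<^sub>R x - y) / e" "0 \<le> s (e *\<^sub>R x + y) (e *\<^sub>R x + y) / e"
    using assms nonneg by simp_all
  moreover have "s (e *\<^sub>R x - y) (e *\<^sub>R x - y) / e = e * s x x + s y y / e - 2 * s x y"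
    "s (e *\<^sub>R x + y) (e *\<^sub>R x + y) / e = e * s x x + s y y / e + 2 * s x y"
    using assms sym[of x y] by (simp_all add: form_simps field_simps)
  ultimately show "2 * s x y \<le> e * s x x + s y y / e" "- 2 * s x y \<le> e * s x x + s y y / e"
    by linarith+
qed

text \<open>Completing the square at \<open>m + r *\<^sub>R c\<close> gives an identity. The factor
  \<open>r / (1 + r)\<close> is the parallel sum of the weights \<open>1\<close> and
  \<open>r\<close>, the best constant for splitting a vector as \<open>m - c\<close>.\<close>

lemma riccati_step:
  assumes "m \<in> V" "c \<in> V" "r \<ge> 0"
  shows "r / (1 + r) * s (m - c) (m - c) \<le> s m m + r * s c c"
proof -
  have "0 \<le> s (m + r *\<^sub>R c) (m + r *\<^sub>R c) / (1 + r)"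
    using assms nonneg by simp
  moreover have "s (m + r *\<^sub>R c) (m + r *\<^sub>R c) / (1 + r)
      = s m m + r * s c c - r / (1 + r) * s (m - c) (m - c)"
    using assms sym[of m c] by (simp add: form_simps divide_simps) (simp add: algebra_simps)
  ultimately show ?thesis by linarith
qed

lemma cauchy_schwarz:
  assumes "x \<in> V" "y \<in> V"
  shows "\<bar>s x y\<bar> \<le> nrm x * nrm y"
proof (cases "x = 0 \<or> y = 0")
  case True
  then show ?thesis using assms by auto
next
  case False
  then have p: "0 < nrm x" "0 < nrm y" using assms pos by auto
  \<comment> \<open>The weight \<open>nrm y / nrm x\<close> balances the two terms of Young's
    inequality.\<close>
  have *: "nrm y / nrm x * s x x + s y y / (nrm y / nrm x) = 2 * (nrm x * nrm y)"
  proof -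
    have "s x x = nrm x * nrm x" "s y y = nrm y * nrm y" using assms nonneg by simp_all
    then show ?thesis using p by (simp add: field_simps)
  qed
  show ?thesis
    using young[OF assms divide_pos_pos[OF p(2,1)]] unfolding * by linarith
qed

section \<open>The Riesz map, dual norm and operator norm\<close>

lemma eqI:
  assumes "x \<in> V" "y \<in> V" "\<And>z. z \<in> V \<Longrightarrow> s x z = s y z"
  shows "x = y"
proof -
  have "s (x - y) (x - y) = 0" using assms by (simp add: diff_left)
  then show ?thesis using assms eq_zero_iff[of "x - y"] by auto
qed

lemma inj: "inj_on s V"
  by (rule inj_onI) (rule eqI, auto)

lemma in_dual: "u \<in> V \<Longrightarrow> s u \<in> dual V nrm"
  unfolding dual_def bounded_linear_on_def
  using off cauchy_schwarz by (auto simp: form_simps intro!: exI[of _ "nrm u"])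

lemma dual_eq: "dual V nrm = s ` V"
  using riesz in_dual by blast

text \<open>Cauchy-Schwarz bounds every quotient and \<open>x = u\<close> attains the bound, so the
  supremum is a maximum; for \<open>u = 0\<close> the convention \<open>0 / 0 = 0\<close> gives the
  right value.\<close>

lemma dual_norm_eq:
  assumes u: "u \<in> V"
  shows "dual_norm V nrm (s u) = nrm u"
proof -
  have le: "\<bar>s u x\<bar> / nrm x \<le> nrm u" if "x \<in> V" for x
    using cauchy_schwarz[OF u that] pos[of x] that nonneg[OF u]
    by (cases "x = 0") (auto simp: divide_le_eq)
  have "nrm u = \<bar>s u u\<bar> / nrm u"
    using nonneg[OF u] by (metis abs_of_nonneg real_div_sqrt)
  then show ?thesis
    unfolding dual_norm_def op_norm_def
    by (intro cSup_eq_maximum) (use le u in auto)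
qed

lemma op_norm_bounds:
  assumes "\<And>x. x \<in> V \<Longrightarrow> T x \<in> V" "\<And>x. x \<in> V \<Longrightarrow> nrm (T x) \<le> c * nrm x" "0 \<le> c"
  shows "0 \<le> op_norm V nrm nrm T" "op_norm V nrm nrm T \<le> c"
proof -
  have le: "nrm (T x) / nrm x \<le> c" if "x \<in> V" for x
    using assms(2)[OF that] pos[of x] that assms(3)
    by (cases "x = 0") (auto simp: divide_le_eq)
  \<comment> \<open>Division by \<open>nrm 0 = 0\<close> gives \<open>0\<close>, so the supremum is
    at least \<open>0\<close>, on the zero space as well.\<close>
  have "nrm (T 0) / nrm 0 \<le> op_norm V nrm nrm T"
    unfolding op_norm_def by (rule cSUP_upper) (use le in \<open>auto simp: bdd_above_def\<close>)
  then show "0 \<le> op_norm V nrm nrm T" by simp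
  show "op_norm V nrm nrm T \<le> c"
    unfolding op_norm_def by (rule cSUP_least) (use le in auto)
qed

text \<open>For a symmetric operator, bounds on the quadratic form are norm bounds. The assumption
  \<open>lower\<close> bounds the form of the inverse by \<open>1 / mu\<close>, written without the
  inverse. The Riesz map \<open>s\<close> is an isometry, so \<open>AA\<close> and \<open>M\<close>
  share their norms and those of their inverses.\<close>

lemma preconditioned_operator:
  assumes M: "\<And>x. x \<in> V \<Longrightarrow> M x \<in> V"
    and symM: "\<And>x y. x \<in> V \<Longrightarrow> y \<in> V \<Longrightarrow> s (M x) y = s x (M y)"
    and surj: "\<And>g. g \<in> V \<Longrightarrow> \<exists>x\<in>V. M x = g"
    and upper: "\<And>x. x \<in> V \<Longrightarrow> \<bar>s (M x) x\<bar> \<le> lam * s x x"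
    and lower: "\<And>x. x \<in> V \<Longrightarrow> mu * \<bar>s (M x) x\<bar> \<le> s (M x) (M x)"
    and lam: "0 < lam" and mu: "0 < mu"
    and AA: "\<And>x. x \<in> V \<Longrightarrow> AA x = s (M x)"
  defines "MM \<equiv> inv_into V s \<circ> AA"
  shows "isomorphism_on V nrm (dual V nrm) (dual_norm V nrm) AA"
    and "isomorphism_on V nrm V nrm MM"
    and "condition_number V nrm (dual V nrm) (dual_norm V nrm) AA = condition_number V nrm V nrm MM"
    and "condition_number V nrm V nrm MM \<le> lam / mu"
proof -
  have MM: "MM x = M x" if "x \<in> V" for x
    using that inj M by (simp add: MM_def AA)
  \<comment> \<open>Linearity follows from symmetry: \<open>M\<close> moves to the other argument,
    and \<open>s\<close> separates points.\<close>
  have Madd: "M (x + y) = M x + M y" if "x \<in> V" "y \<in> V" for x y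
    by (rule eqI) (use that M in \<open>auto simp: symM add_left add_right\<close>)
  have Mscale: "M (c *\<^sub>R x) = c *\<^sub>R M x" if "x \<in> V" for x c
    by (rule eqI) (use that M in \<open>auto simp: symM scale_left scale_right\<close>)
  have Mdiff: "M (x - y) = M x - M y" if "x \<in> V" "y \<in> V" for x y
    by (rule eqI) (use that M in \<open>auto simp: symM diff_left diff_right\<close>)
  \<comment> \<open>polarization turns the bounds on the quadratic form of \<open>M\<close> into norm bounds: below it is
    applied with \<open>y = M x / lam\<close> for \<open>M\<close>, and with \<open>M y = mu x\<close> for the inverse\<close>
  have polar: "4 * s (M x) y = s (M (x + y)) (x + y) - s (M (x - y)) (x - y)"
    if "x \<in> V" "y \<in> V" for x y
    using that M symM[of x y] sym[of x "M y"] by (simp add: Madd Mdiff form_simps)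
  have Mle: "nrm (M x) \<le> lam * nrm x" if x: "x \<in> V" for x
  proof -
    define y where "y = (1 / lam) *\<^sub>R M x"
    have y: "y \<in> V" using M x by (simp add: y_def)
    have "4 * s (M x) y \<le> lam * s (x + y) (x + y) + lam * s (x - y) (x - y)"
      using polar[OF x y] upper[of "x + y"] upper[of "x - y"] x y by (auto simp: abs_le_iff)
    \<comment> \<open>Parallelogram law.\<close>
    also have "\<dots> = 2 * lam * s x x + 2 * lam * s y y"
      using x y by (simp add: form_simps algebra_simps)
    finally have "4 * s (M x) (M x) / lam \<le> 2 * lam * s x x + 2 * s (M x) (M x) / lam"
      using lam M x by (simp add: y_def form_simps)
    then have "s (M x) (M x) \<le> lam\<^sup>2 * s x x"
      using lam by (simp add: field_simps power2_eq_square)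
    then have "nrm (M x) \<le> sqrt (lam\<^sup>2 * s x x)" by simp
    then show ?thesis using lam by (simp add: real_sqrt_mult)
  qed
  have lo: "mu * s (M x) x \<le> s (M x) (M x)" "- (mu * s (M x) x) \<le> s (M x) (M x)"
    if "x \<in> V" for x
    using lower[OF that] mult_left_mono[OF abs_ge_self[of "s (M x) x"], of mu]
      mult_left_mono[OF abs_ge_minus_self[of "s (M x) x"], of mu] mu by linarith+
  have Mge: "nrm x \<le> (1 / mu) * nrm (M x)" if x: "x \<in> V" for x
  proof -
    obtain y where y: "y \<in> V" "M y = mu *\<^sub>R x" using surj[of "mu *\<^sub>R x"] x by auto
    have "4 * mu * s (M x) y = mu * s (M (x + y)) (x + y) - mu * s (M (x - y)) (x - y)"
      using arg_cong[OF polar[OF x y(1)], of "(*) mu"] by (simp add: right_diff_distrib mult.left_commute)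
    also have "\<dots> \<le> s (M (x + y)) (M (x + y)) + s (M (x - y)) (M (x - y))"
      using lo[of "x + y"] lo[of "x - y"] x y(1) by fastforce
    also have "\<dots> = 2 * s (M x) (M x) + 2 * s (M y) (M y)"
      using x y(1) M by (simp add: Madd Mdiff form_simps)
    \<comment> \<open>By symmetry \<open>s (M x) y = s x (M y) = mu * s x x\<close>, and the term
      \<open>s (M y) (M y) = mu\<^sup>2 * s x x\<close> absorbs half of the left side.\<close>
    finally have "mu\<^sup>2 * s x x \<le> s (M x) (M x)"
      using x y by (simp add: symM scale_left scale_right power2_eq_square)
    then have "sqrt (mu\<^sup>2 * s x x) \<le> nrm (M x)" by simp
    then show ?thesis using mu by (simp add: real_sqrt_mult field_simps)
  qed
  have injM: "inj_on M V"
  proof (rule inj_onI)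
    fix x y assume xy: "x \<in> V" "y \<in> V" "M x = M y"
    then have "nrm (x - y) \<le> 0" using Mge[of "x - y"] by (simp add: Mdiff)
    then show "x = y" using xy eq_zero_iff[of "x - y"] nonneg[of "x - y"] by auto
  qed
  have bijM: "bij_betw M V V" using injM M surj by (auto simp: bij_betw_def)
  define R where "R = inv_into V M"
  have R: "R g \<in> V" "M (R g) = g" if "g \<in> V" for g
    using that bijM by (auto simp: R_def bij_betw_def intro: inv_into_into f_inv_into_f)
  have Req: "R g = x" if "x \<in> V" "M x = g" for x g
    using that injM by (auto simp: R_def)
  have Radd: "R (x + y) = R x + R y" if "x \<in> V" "y \<in> V" for x y
    by (rule Req) (use that R in \<open>auto simp: Madd\<close>)
  have Rscale: "R (c *\<^sub>R x) = c *\<^sub>R R x" if "x \<in> V" for x c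
    by (rule Req) (use that R in \<open>auto simp: Mscale\<close>)
  have Rle: "nrm (R x) \<le> (1 / mu) * nrm x" if "x \<in> V" for x
    using Mge[of "R x"] R that by simp
  have bijMM: "bij_betw MM V V" using bijM MM by (metis bij_betw_cong)
  have invMM: "inv_into V MM g = R g" if "g \<in> V" for g
    using that R bijMM by (metis MM bij_betw_inv_into_left)
  have bijS: "bij_betw s V (dual V nrm)" using inj by (simp add: bij_betw_def dual_eq)
  have bijAA: "bij_betw AA V (dual V nrm)"
    using bij_betw_trans[OF bijM bijS] AA by (metis (no_types, lifting) bij_betw_cong comp_apply)
  have invAA: "inv_into V AA (s g) = R g" if "g \<in> V" for g
    using that R bijAA by (metis AA bij_betw_inv_into_left)
  have sadd: "s (x + y) = s x + s y" if "x \<in> V" "y \<in> V" for x y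
    using that off by (auto simp: fun_eq_iff form_simps) (metis add_left add_0 mem(3) off)
  have sscale: "s (c *\<^sub>R x) = c *\<^sub>R s x" if "x \<in> V" for x c
    using that by (auto simp: fun_eq_iff scaleR_fun_def) (metis mem(2) mult_zero_right off scale_left)
  show "isomorphism_on V nrm V nrm MM"
    unfolding isomorphism_on_def bounded_linear_on_def
    using bijMM by (auto simp: MM invMM M R Madd Mscale Radd Rscale intro!: exI Mle Rle)
  show "isomorphism_on V nrm (dual V nrm) (dual_norm V nrm) AA"
    unfolding isomorphism_on_def
  proof (intro conjI)
    show "bounded_linear_on V nrm (dual V nrm) (dual_norm V nrm) AA"
      unfolding bounded_linear_on_def
      by (auto simp: AA M in_dual Madd Mscale sadd sscale dual_norm_eq intro!: exI Mle)
    show "bij_betw AA V (dual V nrm)" by (fact bijAA)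
    show "bounded_linear_on (dual V nrm) (dual_norm V nrm) V nrm (inv_into V AA)"
      \<comment> \<open>Each functional is written as \<open>s g\<close>, on which the inverse of
        \<open>AA\<close> acts as \<open>R g\<close>.\<close>
      unfolding bounded_linear_on_def dual_eq
      by (auto simp: invAA R Radd Rscale dual_norm_eq intro!: exI Rle simp flip: sadd sscale)
  qed
  have "op_norm V nrm (dual_norm V nrm) AA = op_norm V nrm nrm MM"
    unfolding op_norm_def by (rule SUP_cong) (auto simp: AA MM M dual_norm_eq)
  moreover have "op_norm (dual V nrm) (dual_norm V nrm) nrm (inv_into V AA) =
      op_norm V nrm nrm (inv_into V MM)"
    unfolding op_norm_def dual_eq image_image
    by (rule SUP_cong) (auto simp: invAA invMM dual_norm_eq)
  ultimately show "condition_number V nrm (dual V nrm) (dual_norm V nrm) AA = condition_number V nrm V nrm MM"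
    by (simp add: condition_number_def)
  have 1: "0 \<le> op_norm V nrm nrm MM" "op_norm V nrm nrm MM \<le> lam"
    using op_norm_bounds[of MM lam] M Mle lam by (auto simp: MM)
  have 2: "0 \<le> op_norm V nrm nrm (inv_into V MM)" "op_norm V nrm nrm (inv_into V MM) \<le> 1 / mu"
    using op_norm_bounds[of "inv_into V MM" "1 / mu"] R Rle mu by (auto simp: invMM)
  show "condition_number V nrm V nrm MM \<le> lam / mu"
    using mult_mono[OF 1(2) 2(2)] 1 2 lam by (simp add: condition_number_def)
qed

end

subsection \<open>Pivot recursions\<close>

text \<open>With \<open>c k = cos ((k - 1/2) th)\<close>, these are the pivots \<open>e k = c (k + 1) / c k\<close> of \<open>2 cos th - P\<close>,
  where \<open>P\<close> is the path matrix with a loop at the first vertex, whose top eigenvalue is \<open>2 cos th\<close>.\<close>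

lemma upper_pivots:
  fixes n :: nat and th :: real
  assumes n: "1 \<le> n"
  defines "th \<equiv> pi / (2 * n + 1)"
  obtains e :: "nat \<Rightarrow> real" where "e 1 = 2 * cos th - 1" "0 \<le> e n"
    "\<And>k. 1 \<le> k \<Longrightarrow> k < n \<Longrightarrow> 0 < e k \<and> e k \<le> 1 \<and> e (Suc k) = 2 * cos th - 1 / e k"
proof -
  define c where "c k = cos ((real k - 1/2) * th)" for k :: nat
  have th: "0 < th" by (simp add: th_def)
  \<comment> \<open>This choice of \<open>th\<close> makes \<open>c (n + 1)\<close> vanish, so the
    last pivot \<open>e n\<close> is exactly \<open>0\<close>.\<close>
  have fin: "(real n + 1/2) * th = pi / 2" by (simp add: th_def field_simps)
  have rec: "c (Suc (Suc k)) + c k = 2 * cos th * c (Suc k)" for k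
    using cos_add[of "(real k + 1/2) * th" th] cos_diff[of "(real k + 1/2) * th" th]
    by (simp add: c_def algebra_simps)
  have ang: "0 \<le> (real k - 1/2) * th \<and> (real k - 1/2) * th < pi / 2" if "1 \<le> k" "k \<le> n" for k
  proof -
    have "(real k - 1/2) * th < (real n + 1/2) * th" using that th by (intro mult_strict_right_mono) auto
    then show ?thesis using fin that th by simp
  qed
  have pos: "0 < c k" if "1 \<le> k" "k \<le> n" for k
    unfolding c_def using ang[OF that] by (intro cos_gt_zero_pi) auto
  \<comment> \<open>Monotonicity gives \<open>e k \<le> 1\<close>, which later absorbs the
    alternating signs of the diagonal.\<close>
  have mono: "c (Suc k) \<le> c k" if "1 \<le> k" "k < n" for k
  proof -
    have "(real (Suc k) - 1/2) * th \<le> pi" using ang[of "Suc k"] that pi_gt_zero by linarith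
    then show ?thesis unfolding c_def using ang[of k] that th
      by (intro cos_monotone_0_pi_le) (auto intro!: mult_right_mono)
  qed
  define e where "e k = c (Suc k) / c k" for k
  show ?thesis
  proof (rule that[of e])
    \<comment> \<open>Cosine is even and the angles are \<open>-th/2\<close> and
      \<open>th/2\<close>; this boundary condition encodes the loop and yields the first
      pivot.\<close>
    have "c 0 = c 1" by (simp add: c_def)
    then show "e 1 = 2 * cos th - 1"
      using rec[of 0] pos[of 1] n by (simp add: e_def field_simps)
    have "(real (Suc n) - 1/2) * th = pi / 2" using fin by (simp add: algebra_simps)
    then have "c (Suc n) = 0" unfolding c_def by (simp only: cos_pi_half)
    then show "0 \<le> e n" by (simp add: e_def)
    show "0 < e k \<and> e k \<le> 1 \<and> e (Suc k) = 2 * cos th - 1 / e k" if k: "1 \<le> k" "k < n" for k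
      using pos[of k] pos[of "Suc k"] mono[OF k] rec[of k] k by (simp add: e_def field_simps)
  qed
qed

text \<open>The extremal vector of the lower bound solves \<open>w (k + 1) = w k + t k (2 sin (th/2)) z k\<close>,
  \<open>z (k + 1) = z k + w (k + 1)\<close>; it has the closed form used here, and \<open>r k = w (k + 1) / z k\<close>.\<close>

lemma lower_pivots:
  fixes n :: nat and th eps :: real
  assumes n: "1 \<le> n" and eps: "eps = 1 \<or> eps = -1"
  defines "th \<equiv> pi / (2 * n + 1)"
  obtains r :: "nat \<Rightarrow> real" where "r 1 = 1 - eps * (2 * sin (th / 2))"
    "\<And>k. 1 \<le> k \<Longrightarrow> k \<le> n \<Longrightarrow> 0 \<le> r k"
    "\<And>k. 1 \<le> k \<Longrightarrow> k < n \<Longrightarrow>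
      r (Suc k) = r k / (1 + r k) - eps * (2 * sin (th / 2)) * (-1) ^ k"
proof -
  define t where "t k = eps * (-1) ^ k" for k :: nat
  define w where "w k = cos (pi/4 + t k * ((real k - 1/2) * (th / 2)))" for k :: nat
  define z where "z k = sin (pi/4 - t k * (th / 4)) * sin (real k * (th / 2)) / sin (th / 2)" for k
  have t: "t k = 1 \<or> t k = -1" "t (Suc k) = - t k" for k
    using eps by (cases "even k") (auto simp: t_def)
  have th: "0 < th" "th \<le> pi / 3" using n by (auto simp: th_def field_simps)
  \<comment> \<open>Up to \<open>k = n + 1\<close> the angle in \<open>w k\<close> differs from
    \<open>pi/4\<close> by at most \<open>pi/4\<close>, so the cosine stays nonnegative that
    far.\<close>
  have fin: "(real n + 1/2) * (th / 2) = pi / 4" by (simp add: th_def field_simps)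
  have spos: "0 < sin (th / 2)" using th by (intro sin_gt_zero) auto
  have zpos: "0 < z k" if "1 \<le> k" "k \<le> n" for k
  proof -
    have "real k * (th / 2) \<le> (real n + 1/2) * (th / 2)"
      using that th by (intro mult_right_mono) auto
    then have "real k * (th / 2) < pi" using fin pi_gt_zero by linarith
    then have "0 < sin (real k * (th / 2))" using that th by (intro sin_gt_zero) auto
    moreover have "0 < sin (pi/4 - t k * (th / 4))"
      using t(1)[of k] th by (intro sin_gt_zero) auto
    ultimately show ?thesis using spos by (simp add: z_def)
  qed
  have wnn: "0 \<le> w k" if "1 \<le> k" "k \<le> Suc n" for k
  proof -
    define a where "a = (real k - 1/2) * (th / 2)"
    have "a \<le> (real n + 1/2) * (th / 2)"
      unfolding a_def using that th by (intro mult_right_mono) auto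
    then have "a \<le> pi / 4" "0 \<le> a" unfolding fin using that th by (simp_all add: a_def)
    then show ?thesis
      unfolding w_def a_def[symmetric] using t(1)[of k] pi_gt_zero
      by (intro cos_ge_zero; elim disjE; simp)
  qed
  have cs': "cos (pi/4 - u) = sin (pi/4 + u)" for u :: real
    using sin_cos_eq[of "pi/4 + u"] by (simp add: algebra_simps)
  have cs: "cos (pi/4 + u) = sin (pi/4 - u)" for u :: real
    using sin_cos_eq[of "pi/4 - u"] by (simp add: algebra_simps)
  have w1: "w 1 = z 1" using spos by (simp add: w_def z_def cs)
  have step_w: "w (Suc k) = w k + t k * (2 * sin (th / 2)) * z k" if "1 \<le> k" for k
  proof -
    \<comment> \<open>Since \<open>t\<close> changes sign, half the sum of the two angles is
      \<open>pi/4 - t k * (th/4)\<close> and half their difference is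
      \<open>- t k * real k * (th/2)\<close>; their sines are the factors of
      \<open>z k\<close>.\<close>
    have "w k - w (Suc k) = 2 * sin ((pi/2 - t k * (th/2)) / 2) * sin (- t k * real k * (th/2))"
      unfolding w_def t(2) cos_diff_cos
      by (rule arg_cong2[of _ _ _ _ "\<lambda>x y. 2 * sin x * sin y"]) (auto simp: algebra_simps)
    also have "\<dots> = - t k * (2 * sin (th/2)) * z k"
      using t(1)[of k] spos unfolding z_def diff_divide_distrib by (auto simp: algebra_simps)
    finally show ?thesis by simp
  qed
  have step_z: "z (Suc k) = z k + w (Suc k)" for k
  proof -
    define a where "a = real k * (th/2)"
    define b where "b = t k * (th / 4)"
    have "2 * (sin (pi/4 + b) * sin (a + th/2) - sin (pi/4 - b) * sin a)
       = (cos (pi/4 + b - (a + th/2)) - cos (pi/4 + b + (a + th/2)))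
       - (cos (pi/4 - b - a) - cos (pi/4 - b + a))"
      unfolding sin_times_sin by (simp add: field_simps)
    \<comment> \<open>For either sign two of the four cosines cancel, and the remaining two combine
      into one product.\<close>
    also have "\<dots> = 2 * (sin (th/2) * cos (pi/4 - t k * (a + th/4)))"
      using t(1)[of k]
    proof
      assume tk: "t k = 1"
      have e: "pi/4 + b - (a + th/2) = pi/4 - b - a" "pi/4 + b + (a + th/2) = pi/4 + (a + 3*th/4)"
        "pi/4 - b + a = pi/4 + (a - th/4)"
        using tk by (simp_all add: b_def)
      have "cos (pi/4 + (a - th/4)) - cos (pi/4 + (a + 3*th/4)) = 2 * sin (pi/4 + (a + th/4)) * sin (th/2)"
        unfolding cos_diff_cos
        by (rule arg_cong2[of _ _ _ _ "\<lambda>x y. 2 * sin x * sin y"]) (auto simp: field_simps)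
      then show ?thesis unfolding e using cs'[of "a + th/4"] tk by simp
    next
      assume tk: "t k = -1"
      have e: "pi/4 + b - (a + th/2) = pi/4 - (a + 3*th/4)" "pi/4 + b + (a + th/2) = pi/4 - b + a"
        "pi/4 - b - a = pi/4 - (a - th/4)"
        using tk by (simp_all add: b_def)
      have A1: "cos (pi/4 - (a + 3*th/4)) - cos (pi/4 - (a - th/4)) = 2 * sin (pi/4 - (a + th/4)) * sin (th/2)"
        unfolding cos_diff_cos
        by (rule arg_cong2[of _ _ _ _ "\<lambda>x y. 2 * sin x * sin y"]) (auto simp: field_simps)
      have A2: "pi/4 - t k * (a + th/4) = pi/4 + (a + th/4)" using tk by simp
      show ?thesis unfolding e A2 cs using A1 by simp
    qed
    finally have f: "sin (pi/4 + b) * sin (a + th/2) - sin (pi/4 - b) * sin a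
       = sin (th/2) * cos (pi/4 - t k * (a + th/4))" by simp
    have g: "a + th/2 = real (Suc k) * (th/2)" "a + th/4 = (real (Suc k) - 1/2) * (th/2)"
      "pi/4 + b = pi/4 - t (Suc k) * (th/4)"
      by (simp_all add: a_def b_def t(2) algebra_simps)
    have "sin (pi/4 - t (Suc k) * (th/4)) * sin (real (Suc k) * (th/2))
        = sin (pi/4 - t k * (th/4)) * sin (real k * (th/2)) + sin (th/2) * w (Suc k)"
      unfolding w_def using f unfolding g unfolding a_def b_def t(2) by simp
    then show ?thesis using spos by (simp add: z_def field_simps)
  qed
  define r where "r k = w (Suc k) / z k" for k
  show ?thesis
  proof (rule that[of r])
    show "r 1 = 1 - eps * (2 * sin (th / 2))"
      using step_w[of 1] w1 zpos[of 1] n by (simp add: r_def t_def field_simps)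
    show "0 \<le> r k" if "1 \<le> k" "k \<le> n" for k
      using zpos[of k] wnn[of "Suc k"] that by (simp add: r_def)
    show "r (Suc k) = r k / (1 + r k) - eps * (2 * sin (th / 2)) * (-1) ^ k" if k: "1 \<le> k" "k < n" for k
    proof -
      have p: "0 < z k" "0 < z (Suc k)" using zpos k by auto
      \<comment> \<open>The quotient \<open>w (k + 1) / z k\<close> linearises the Riccati
        recursion: \<open>r k / (1 + r k)\<close> only replaces the denominator by
        \<open>z (k + 1)\<close>.\<close>
      have "1 + r k = z (Suc k) / z k" using p by (simp add: r_def step_z add_divide_distrib)
      then have "r k / (1 + r k) = w (Suc k) / z (Suc k)" using p by (simp add: r_def)
      moreover have "r (Suc k) = w (Suc k) / z (Suc k) - t k * (2 * sin (th / 2))"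
        using p step_w[of "Suc k"] by (simp add: r_def t(2) field_simps)
      ultimately show ?thesis by (simp add: t_def)
    qed
  qed
qed

subsection \<open>Chains of Hilbert spaces\<close>

lemma sum_tridiag:
  fixes t :: "nat \<Rightarrow> nat \<Rightarrow> real"
  assumes far: "\<And>i j. i + 1 < j \<or> j + 1 < i \<Longrightarrow> t i j = 0"
  shows "(\<Sum>i=1..n. \<Sum>j=1..n. t i j) =
    (\<Sum>i=1..n. t i i) + (\<Sum>i\<in>{1..<n}. t i (i + 1) + t (i + 1) i)"
proof (induction n)
  case (Suc n)
  \<comment> \<open>In the added row and column only the neighbour of the corner survives; for
    \<open>n = 0\<close> there is none.\<close>
  have "(\<Sum>i=1..n. t i (Suc n)) = (if n = 0 then 0 else t n (Suc n))"
    "(\<Sum>j=1..n. t (Suc n) j) = (if n = 0 then 0 else t (Suc n) n)"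
    using far by (cases n; simp)+
  then show ?case
    using Suc.IH by (cases n) (simp_all add: sum.distrib)
qed simp

lemma sum_if_less_left:
  "(\<Sum>i=1..n::nat. if 1 < i then f i else 0) = (\<Sum>i\<in>{1..<n}. f (i + 1) :: real)"
proof (induction n)
  case (Suc n)
  then show ?case by (cases n) auto
qed simp

lemma sum_if_less_right:
  "(\<Sum>i=1..n::nat. if i < n then f i else 0) = (\<Sum>i\<in>{1..<n}. f i :: real)"
  by (rule sum.mono_neutral_cong_right) auto

text \<open>In the application \<open>T i\<close> is
  \<open>S\<^sub>i\<^sup>-\<^sup>1 B\<^sub>i'\<close> and \<open>G i\<close> is
  \<open>S\<^sub>i\<^sub>+\<^sub>1\<^sup>-\<^sup>1 B\<^sub>i\<close>, adjoint to each other in the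
  Schur inner products; \<open>contr\<close> expresses that \<open>A\<^sub>i\<^sub>+\<^sub>1\<close>
  is positive semi-definite.\<close>

locale block_chain =
  fixes n :: nat and V :: "nat \<Rightarrow> 'a::real_vector set" and s :: "nat \<Rightarrow> 'a \<Rightarrow> 'a \<Rightarrow> real"
    and T G :: "nat \<Rightarrow> 'a \<Rightarrow> 'a"
  assumes n: "1 \<le> n"
    and block: "i \<in> {1..n} \<Longrightarrow> hilbert_form (V i) (s i)"
    and T: "i \<in> {1..<n} \<Longrightarrow> y \<in> V (i + 1) \<Longrightarrow> T i y \<in> V i"
    and G: "i \<in> {1..<n} \<Longrightarrow> x \<in> V i \<Longrightarrow> G i x \<in> V (i + 1)"
    and adjoint: "i \<in> {1..<n} \<Longrightarrow> x \<in> V i \<Longrightarrow> y \<in> V (i + 1) \<Longrightarrow> s (i + 1) (G i x) y = s i x (T i y)"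
    and contr: "i \<in> {1..<n} \<Longrightarrow> y \<in> V (i + 1) \<Longrightarrow> s i (T i y) (T i y) \<le> s (i + 1) y y"
begin

text \<open>The adjoint of a contraction is a contraction: Young's inequality with weight
  \<open>1\<close> for \<open>x\<close> and \<open>T i (G i x)\<close> leaves half of the
  \<open>G\<close> term to cancel.\<close>

lemma G_contr:
  assumes i: "i \<in> {1..<n}" and x: "x \<in> V i"
  shows "s (i + 1) (G i x) (G i x) \<le> s i x x"
proof -
  interpret hilbert_form "V i" "s i" using block i by simp
  have "s (i + 1) (G i x) (G i x) = s i x (T i (G i x))"
    using adjoint G i x by simp
  then show ?thesis
    using young(1)[OF x T[OF i G[OF i x]], of 1] contr[OF i G[OF i x]] by simp
qed

text \<open>Here \<open>q k\<close> is the form of the leading \<open>k\<close> blocks. The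
  induction keeps \<open>e k\<close> times the square norm of the last block unspent, to pay for its
  coupling with the next block.\<close>

lemma upper_bound:
  fixes x :: "nat \<Rightarrow> 'a"
  defines "q k \<equiv> (\<Sum>i=1..k. (-1) ^ (i - 1) * (s i (x i) (x i)
      - (if 1 < i then s (i - 1) (T (i - 1) (x i)) (T (i - 1) (x i)) else 0)))
      + 2 * (\<Sum>i\<in>{1..<k}. s i (x i) (T i (x (i + 1))))"
  assumes x: "\<And>i. i \<in> {1..n} \<Longrightarrow> x i \<in> V i"
  shows "\<bar>q n\<bar> \<le> 2 * cos (pi / (2 * n + 1)) * (\<Sum>i=1..n. s i (x i) (x i))"
proof -
  define lam where "lam = 2 * cos (pi / (2 * n + 1))"
  obtain e :: "nat \<Rightarrow> real" where e1: "e 1 = lam - 1" and en: "0 \<le> e n"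
    and e: "\<And>k. 1 \<le> k \<Longrightarrow> k < n \<Longrightarrow> 0 < e k \<and> e k \<le> 1 \<and> e (Suc k) = lam - 1 / e k"
    using upper_pivots[OF n] unfolding lam_def by metis
  have xx: "0 \<le> s i (x i) (x i)" if "i \<in> {1..n}" for i
    using hilbert_form.nonneg[OF block] x that by blast
  have main: "\<bar>q k\<bar> \<le> lam * (\<Sum>i=1..k. s i (x i) (x i)) - e k * s k (x k) (x k)"
    if "1 \<le> k" "k \<le> n" for k
    using that
  proof (induction k rule: nat_induct_at_least)
    case base
    have "lam = e (Suc 0) + 1" using e1 by simp
    then show ?case using xx[of 1] n by (simp add: q_def distrib_right)
  next
    case (Suc k)
    then have k: "k \<in> {1..<n}" "1 \<le> k" "k < n" by auto
    interpret hilbert_form "V k" "s k" using block k by simp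
    define y where "y = T k (x (Suc k))"
    define xi where "xi = s (Suc k) (x (Suc k)) (x (Suc k))"
    have xk: "x k \<in> V k" and y: "y \<in> V k" using x T k by (auto simp: y_def)
    have yxi: "s k y y \<le> xi" using contr[OF k(1), of "x (Suc k)"] x k by (simp add: y_def xi_def)
    have ek: "0 < e k" "e k \<le> 1" "e (Suc k) = lam - 1 / e k" using e k by auto
    have "q (Suc k) = q k + ((-1) ^ k * (xi - s k y y) + 2 * s k (x k) y)"
      using k by (simp add: q_def y_def xi_def algebra_simps)
    \<comment> \<open>The difference is nonnegative by contraction and \<open>e k \<le> 1\<close>,
      so either sign of the diagonal is covered.\<close>
    moreover have "\<bar>(-1) ^ k * (xi - s k y y)\<bar> \<le> (xi - s k y y) / e k"
      using ek yxi by (simp add: abs_mult pos_le_divide_eq mult_left_le)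
    moreover have "\<bar>2 * s k (x k) y\<bar> \<le> e k * s k (x k) (x k) + s k y y / e k"
      using young[OF xk y ek(1)] by (simp add: abs_le_iff)
    \<comment> \<open>The \<open>y\<close> terms cancel, and what remains is the pivot recursion
      multiplied by \<open>xi\<close>.\<close>
    moreover have "(xi - s k y y) / e k + s k y y / e k = lam * xi - e (Suc k) * xi"
      unfolding ek(3) by (simp add: algebra_simps diff_divide_distrib)
    ultimately show ?case
      using Suc by (simp add: xi_def[symmetric] algebra_simps)
  qed
  show ?thesis
    using main[OF n] mult_nonneg_nonneg[OF en xx[of n]] n unfolding lam_def by simp
qed

text \<open>Here \<open>m = L z\<close>. The induction keeps a surplus of \<open>r k\<close> times
  the square norm of \<open>z k\<close>; since \<open>G\<close> is a contraction this pays for the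
  coupling term in \<open>m (k + 1)\<close> through \<open>riccati_step\<close>.\<close>

lemma lower_bound:
  fixes z :: "nat \<Rightarrow> 'a"
  defines "m i \<equiv> z i + (if 1 < i then (-1) ^ i *\<^sub>R G (i - 1) (z (i - 1)) else 0)"
  assumes z: "\<And>i. i \<in> {1..n} \<Longrightarrow> z i \<in> V i"
  shows "2 * sin (pi / (2 * n + 1) / 2) * \<bar>\<Sum>i=1..n. (-1) ^ (i - 1) * s i (z i) (z i)\<bar>
    \<le> (\<Sum>i=1..n. s i (m i) (m i))"
proof -
  define mu where "mu = 2 * sin (pi / (2 * n + 1) / 2)"
  have zz: "0 \<le> s i (z i) (z i)" if "i \<in> {1..n}" for i
    using hilbert_form.nonneg[OF block] z that by blast
  \<comment> \<open>The two signs \<open>eps\<close> together give the absolute value; each has its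
    own pivot sequence because the diagonal alternates.\<close>
  have main: "eps * mu * (\<Sum>i=1..n. (-1) ^ (i - 1) * s i (z i) (z i)) \<le> (\<Sum>i=1..n. s i (m i) (m i))"
    if eps: "eps = 1 \<or> eps = -1" for eps
  proof -
    obtain r :: "nat \<Rightarrow> real" where r1: "r 1 = 1 - eps * mu"
      and r0: "\<And>k. 1 \<le> k \<Longrightarrow> k \<le> n \<Longrightarrow> 0 \<le> r k"
      and r: "\<And>k. 1 \<le> k \<Longrightarrow> k < n \<Longrightarrow> r (Suc k) = r k / (1 + r k) - eps * mu * (-1) ^ k"
      using lower_pivots[OF n eps] unfolding mu_def by metis
    have "eps * mu * (\<Sum>i=1..k. (-1) ^ (i - 1) * s i (z i) (z i))
        \<le> (\<Sum>i=1..k. s i (m i) (m i)) - r k * s k (z k) (z k)" if "1 \<le> k" "k \<le> n" for k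
      using that
    proof (induction k rule: nat_induct_at_least)
      case base
      have "r (Suc 0) = 1 - eps * mu" using r1 by simp
      then show ?case by (simp add: m_def left_diff_distrib)
    next
      case (Suc k)
      then have k: "k \<in> {1..<n}" "1 \<le> k" "k < n" by auto
      interpret hilbert_form "V (Suc k)" "s (Suc k)" using block k by simp
      define c where "c = (-1) ^ Suc k *\<^sub>R G k (z k)"
      have zk: "z k \<in> V k" "z (Suc k) \<in> V (Suc k)" using z k by auto
      have g: "G k (z k) \<in> V (Suc k)" using G[OF k(1) zk(1)] by simp
      then have c: "c \<in> V (Suc k)" unfolding c_def by (rule mem)
      have "s (Suc k) c c = s (Suc k) (G k (z k)) (G k (z k))"
        using g by (cases "even k") (simp_all add: c_def form_simps)
      then have cz: "r k * s (Suc k) c c \<le> r k * s k (z k) (z k)"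
        using G_contr[OF k(1) zk(1)] r0[of k] k by (intro mult_left_mono) auto
      have m: "m (Suc k) = z (Suc k) + c" using k by (simp add: m_def c_def)
      \<comment> \<open>Applied to \<open>m = z (k + 1) + c\<close>, so that \<open>m - c\<close> is
        the new block.\<close>
      have "r k / (1 + r k) * s (Suc k) (z (Suc k)) (z (Suc k))
          \<le> s (Suc k) (m (Suc k)) (m (Suc k)) + r k * s (Suc k) c c"
        using riccati_step[of "z (Suc k) + c" c "r k"] zk c r0[of k] k by (simp add: m)
      moreover have "r k / (1 + r k) * s (Suc k) (z (Suc k)) (z (Suc k))
          = (r (Suc k) + eps * mu * (-1) ^ k) * s (Suc k) (z (Suc k)) (z (Suc k))"
        using r[OF k(2,3)] by simp
      ultimately show ?case
        using Suc cz by (simp add: algebra_simps)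
    qed
    from this[OF n order.refl] show ?thesis
      using mult_nonneg_nonneg[OF r0[OF n order.refl] zz[of n]] n by (simp del: zero_le_mult_iff)
  qed
  then show ?thesis using main[of 1] main[of "-1"] by (simp add: mu_def abs_if)
qed

section \<open>The product of the blocks as one Hilbert space\<close>

abbreviation "W \<equiv> product_space n V"

definition total :: "(nat \<Rightarrow> 'a) \<Rightarrow> (nat \<Rightarrow> 'a) \<Rightarrow> real"
  where "total x y = (if y \<in> W then \<Sum>i=1..n. s i (x i) (y i) else 0)"

lemma W_mem: "x \<in> W \<Longrightarrow> i \<in> {1..n} \<Longrightarrow> x i \<in> V i"
  by (simp add: product_space_def)

lemma W_I: "(\<And>i. i \<in> {1..n} \<Longrightarrow> x i \<in> V i) \<Longrightarrow> (\<lambda>i. if i \<in> {1..n} then x i else 0) \<in> W"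
  by (simp add: product_space_def)

lemma subspace_W: "subspace W"
proof (rule subspaceI)
  have sub: "subspace (V i)" if "i \<in> {1..n}" for i
    using block[OF that] by (rule hilbert_form.subspace)
  show "0 \<in> W" using sub by (auto simp: product_space_def subspace_0)
  show "x + y \<in> W" if "x \<in> W" "y \<in> W" for x y
    using that sub by (auto simp: product_space_def subspace_add)
  show "c *\<^sub>R x \<in> W" if "x \<in> W" for c x
    using that sub by (auto simp: product_space_def subspace_scale scaleR_fun_def)
qed

text \<open>A functional restricts along the coordinate embeddings to functionals on the blocks;
  their Riesz representatives, put together, represent it.\<close>

lemma total_riesz:
  assumes f: "f \<in> dual W (\<lambda>x. sqrt (total x x))"
  shows "\<exists>u\<in>W. total u = f"
proof -
  define emb where "emb i v = (\<lambda>j::nat. if j = i then v else (0::'a))" for i v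
  \<comment> \<open>The embeddings are isometric, so the bound \<open>C\<close> of \<open>f\<close>
    carries over to every block.\<close>
  have emb_W: "emb i v \<in> W" if "i \<in> {1..n}" "v \<in> V i" for i v
    using that hilbert_form.mem(1)[OF block] by (auto simp: emb_def product_space_def)
  have emb_total: "total (emb i v) (emb i v) = s i v v" if i: "i \<in> {1..n}" and v: "v \<in> V i" for i v
  proof -
    have "total (emb i v) (emb i v) = (\<Sum>j=1..n. if j = i then s i v v else 0)"
      unfolding total_def if_P[OF emb_W[OF i v]]
    proof (rule sum.cong)
      fix j assume "j \<in> {1..n}"
      then interpret hilbert_form "V j" "s j" by (rule block)
      show "s j (emb i v j) (emb i v j) = (if j = i then s i v v else 0)"
        by (simp add: emb_def)
    qed simp
    then show ?thesis using i by simp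
  qed
  have fadd: "f (x + y) = f x + f y" if "x \<in> W" "y \<in> W" for x y
    using f that by (simp add: dual_def bounded_linear_on_def)
  have fscale: "f (c *\<^sub>R x) = c * f x" if "x \<in> W" for c x
    using f that by (simp add: dual_def bounded_linear_on_def)
  obtain C where C: "\<And>x. x \<in> W \<Longrightarrow> \<bar>f x\<bar> \<le> C * sqrt (total x x)"
    using f unfolding dual_def bounded_linear_on_def mem_Collect_eq by blast
  have "\<exists>u\<in>V i. \<forall>v\<in>V i. s i u v = f (emb i v)" if i: "i \<in> {1..n}" for i
  proof -
    define g where "g v = (if v \<in> V i then f (emb i v) else 0)" for v
    interpret hilbert_form "V i" "s i" using block[OF i] .
    have "emb i (x + y) = emb i x + emb i y" "emb i (c *\<^sub>R x) = c *\<^sub>R emb i x" for x y c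
      by (auto simp: emb_def fun_eq_iff scaleR_fun_def)
    then have "g \<in> dual (V i) (\<lambda>x. sqrt (s i x x))"
      unfolding dual_def bounded_linear_on_def
      using C[OF emb_W[OF i]] fadd[OF emb_W[OF i] emb_W[OF i]] fscale[OF emb_W[OF i]]
      by (auto simp: g_def emb_total[OF i] intro!: exI[of _ C])
    from riesz[OF this] obtain u where "u \<in> V i" "s i u = g" by blast
    then have "s i u v = f (emb i v)" if "v \<in> V i" for v using that by (simp add: g_def)
    then show ?thesis using \<open>u \<in> V i\<close> by blast
  qed
  then obtain u where u: "\<And>i. i \<in> {1..n} \<Longrightarrow> u i \<in> V i \<and> (\<forall>v\<in>V i. s i (u i) v = f (emb i v))"
    by metis
  define u' where "u' = (\<lambda>i. if i \<in> {1..n} then u i else 0)"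
  have u': "u' \<in> W" unfolding u'_def using u by (intro W_I) auto
  have "total u' y = f y" for y
  proof (cases "y \<in> W")
    case True
    \<comment> \<open>Truncations of \<open>y\<close> split \<open>f y\<close> into block
      contributions by induction; \<open>p n\<close> is \<open>y\<close>.\<close>
    define p where "p k = (\<lambda>j. if j \<in> {1..k} then y j else 0)" for k
    have pW: "p k \<in> W" for k
      using True hilbert_form.mem(1)[OF block] by (auto simp: p_def product_space_def)
    have "f (p k) = (\<Sum>i=1..k. f (emb i (y i)))" if "k \<le> n" for k
      using that
    proof (induction k)
      case 0
      have "p 0 = 0 *\<^sub>R p 0" by (auto simp: p_def fun_eq_iff scaleR_fun_def)
      then have "f (p 0) = 0 * f (p 0)" using fscale[OF pW] by metis
      then show ?case by simp
    next
      case (Suc k)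
      have "p (Suc k) = p k + emb (Suc k) (y (Suc k))"
        by (auto simp: p_def emb_def fun_eq_iff)
      then have "f (p (Suc k)) = f (p k) + f (emb (Suc k) (y (Suc k)))"
        using fadd[OF pW emb_W, of "Suc k" "y (Suc k)" k] W_mem[OF True, of "Suc k"] Suc.prems
        by (simp only:) simp
      then show ?case using Suc by simp
    qed
    moreover have "p n = y" using True by (auto simp: p_def product_space_def fun_eq_iff)
    ultimately have "f y = (\<Sum>i=1..n. f (emb i (y i)))" by force
    then show ?thesis using True u W_mem[OF True] by (simp add: total_def u'_def)
  next
    case False
    then show ?thesis using f by (simp add: total_def dual_def)
  qed
  then show ?thesis using u' by blast
qed

lemma total_form: "hilbert_form W total"
proof
  show "subspace W" by (fact subspace_W)
  show "total (x + y) z = total x z + total y z" if "x \<in> W" "y \<in> W" "z \<in> W" for x y z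
    using that by (auto simp: total_def W_mem hilbert_form.add_left[OF block] simp flip: sum.distrib intro!: sum.cong)
  show "total (c *\<^sub>R x) z = c * total x z" if "x \<in> W" "z \<in> W" for x z c
    using that by (auto simp: total_def scaleR_fun_def sum_distrib_left W_mem hilbert_form.scale_left[OF block] intro!: sum.cong)
  show "total x y = total y x" if "x \<in> W" "y \<in> W" for x y
    unfolding total_def using that W_mem hilbert_form.sym[OF block]
    by simp
  show "0 < total x x" if x: "x \<in> W" "x \<noteq> 0" for x
  proof -
    obtain i where i: "x i \<noteq> 0" using x(2) by (auto simp: fun_eq_iff)
    then have "i \<in> {1..n}" using x(1) by (auto simp: product_space_def)
    then have "0 < (\<Sum>i=1..n. s i (x i) (x i))"
      using i x W_mem hilbert_form.nonneg[OF block] hilbert_form.pos[OF block]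
      by (intro sum_pos2[of _ i]) auto
    then show ?thesis using x by (simp add: total_def)
  qed
  show "total x y = 0" if "y \<notin> W" for x y
    using that by (simp add: total_def)
  show "\<exists>u\<in>W. total u = f" if "f \<in> dual W (\<lambda>x. sqrt (total x x))" for f
    using total_riesz that .
qed

text \<open>The operator is \<open>mmap = L D L\<^sup>*\<close> with \<open>L\<close> unit lower bidiagonal and
  \<open>D = diag(1, -1, 1, \<dots>)\<close>; here \<open>zmap = D L\<^sup>*\<close> and \<open>lmap = L\<close>.\<close>

definition zmap :: "(nat \<Rightarrow> 'a) \<Rightarrow> nat \<Rightarrow> 'a"
  where "zmap x i = (-1) ^ (i - 1) *\<^sub>R x i + (if i < n then T i (x (i + 1)) else 0)"

definition lmap :: "(nat \<Rightarrow> 'a) \<Rightarrow> nat \<Rightarrow> 'a"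
  where "lmap z i = (if i \<in> {1..n}
    then z i + (if 1 < i then (-1) ^ i *\<^sub>R G (i - 1) (z (i - 1)) else 0) else 0)"

definition mmap :: "(nat \<Rightarrow> 'a) \<Rightarrow> nat \<Rightarrow> 'a"
  where "mmap x = lmap (zmap x)"

section \<open>The factorised operator: quadratic form and surjectivity\<close>

lemma zmap_mem: "x \<in> W \<Longrightarrow> i \<in> {1..n} \<Longrightarrow> zmap x i \<in> V i"
  unfolding zmap_def using W_mem T hilbert_form.mem[OF block] by auto

lemma lmap_mem:
  assumes z: "\<And>i. i \<in> {1..n} \<Longrightarrow> z i \<in> V i"
  shows "lmap z \<in> W"
  unfolding lmap_def
proof (rule W_I)
  fix i assume i: "i \<in> {1..n}"
  interpret hilbert_form "V i" "s i" using block[OF i] .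
  have "G (i - 1) (z (i - 1)) \<in> V i" if "1 < i"
  proof -
    obtain k where "i = Suc k" "1 \<le> k" using \<open>1 < i\<close> by (cases i) auto
    then show ?thesis using G[of k "z k"] z[of k] i by simp
  qed
  then show "z i + (if 1 < i then (-1) ^ i *\<^sub>R G (i - 1) (z (i - 1)) else 0) \<in> V i"
    using z[OF i] by auto
qed

lemma mmap_mem: "x \<in> W \<Longrightarrow> mmap x \<in> W"
  unfolding mmap_def by (intro lmap_mem zmap_mem)

text \<open>Moving \<open>L\<close> to the other argument gives \<open>L\<^sup>*\<close>, which is
  \<open>D\<close> times \<open>zmap\<close> because \<open>D\<close> squares to the identity. The
  right side is visibly symmetric and diagonal in \<open>zmap\<close>, as \<open>lower_bound\<close>
  requires.\<close>

lemma total_mmap: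
  assumes x: "x \<in> W" and y: "y \<in> W"
  shows "total (mmap x) y = (\<Sum>i=1..n. (-1) ^ (i - 1) * s i (zmap x i) (zmap y i))"
proof -
  define z where "z = zmap x"
  have z: "z i \<in> V i" if "i \<in> {1..n}" for i using zmap_mem[OF x that] by (simp add: z_def)
  have "total (mmap x) y = (\<Sum>i=1..n. s i (z i) (y i)
      + (if 1 < i then (-1) ^ i * s i (G (i - 1) (z (i - 1))) (y i) else 0))"
    unfolding total_def if_P[OF y] mmap_def z_def[symmetric]
  proof (rule sum.cong)
    fix i assume i: "i \<in> {1..n}"
    show "s i (lmap z i) (y i) = s i (z i) (y i)
      + (if 1 < i then (-1) ^ i * s i (G (i - 1) (z (i - 1))) (y i) else 0)"
    proof (cases "1 < i")
      case True
      then obtain k where k: "i = Suc k" "1 \<le> k" by (cases i) auto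
      interpret hilbert_form "V (Suc k)" "s (Suc k)" using block[OF i] k by simp
      show ?thesis
        using k G[of k "z k"] z[of k] i z[OF i] W_mem[OF y i]
        by (cases "even k") (simp_all add: lmap_def add_left diff_left)
    qed (use i in \<open>simp add: lmap_def\<close>)
  qed simp
  also have "\<dots> = (\<Sum>i=1..n. s i (z i) (y i))
      + (\<Sum>i\<in>{1..<n}. (-1) ^ (i + 1) * s (i + 1) (G i (z i)) (y (i + 1)))"
    unfolding sum.distrib sum_if_less_left by simp
  also have "(\<Sum>i\<in>{1..<n}. (-1) ^ (i + 1) * s (i + 1) (G i (z i)) (y (i + 1)))
      = (\<Sum>i\<in>{1..<n}. (-1) ^ (i + 1) * s i (z i) (T i (y (i + 1))))"
    by (rule sum.cong) (auto simp: adjoint[simplified] z W_mem[OF y])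
  also have "(\<Sum>i=1..n. s i (z i) (y i)) + \<dots> = (\<Sum>i=1..n. s i (z i) (y i)
      + (if i < n then (-1) ^ (i + 1) * s i (z i) (T i (y (i + 1))) else 0))"
    unfolding sum.distrib sum_if_less_right ..
  also have "\<dots> = (\<Sum>i=1..n. (-1) ^ (i - 1) * s i (z i) (zmap y i))"
  proof (rule sum.cong)
    fix i assume i: "i \<in> {1..n}"
    obtain k where k: "i = Suc k" using i by (cases i) auto
    interpret hilbert_form "V (Suc k)" "s (Suc k)" using block[OF i] k by simp
    have "T i (y (i + 1)) \<in> V i" if "i < n" using T[of i] W_mem[OF y, of "i + 1"] that i by simp
    then show "s i (z i) (y i) + (if i < n then (-1) ^ (i + 1) * s i (z i) (T i (y (i + 1))) else 0)
      = (-1) ^ (i - 1) * s i (z i) (zmap y i)"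
      using z[OF i] W_mem[OF y i] unfolding zmap_def k
      by (simp add: add_right scale_right distrib_left flip: power_add mult_2)
  qed simp
  finally show ?thesis by (simp add: z_def)
qed

text \<open>Multiplying out \<open>zmap\<close> returns to the original variables: the bracket
  becomes the block \<open>A i\<close>, the last sum the couplings by \<open>B i\<close>.
  \<open>upper_bound\<close> works on this shape.\<close>

lemma total_mmap_expand:
  assumes x: "x \<in> W" and y: "y \<in> W"
  shows "total (mmap x) y = (\<Sum>i=1..n. (-1) ^ (i - 1) * (s i (x i) (y i)
      - (if 1 < i then s (i - 1) (T (i - 1) (x i)) (T (i - 1) (y i)) else 0)))
      + (\<Sum>i\<in>{1..<n}. s i (x i) (T i (y (i + 1))) + s i (T i (x (i + 1))) (y i))"
proof -
  have "(\<Sum>i=1..n. (-1) ^ (i - 1) * (s i (x i) (y i)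
      - (if 1 < i then s (i - 1) (T (i - 1) (x i)) (T (i - 1) (y i)) else 0)))
    = (\<Sum>i=1..n. (-1) ^ (i - 1) * s i (x i) (y i)
      + (if 1 < i then - ((-1) ^ (i - 1)) * s (i - 1) (T (i - 1) (x i)) (T (i - 1) (y i)) else 0))"
    by (rule sum.cong) (auto simp: right_diff_distrib)
  \<comment> \<open>The shift by one index flips the sign: \<open>- ((-1) ^ i)\<close> is the entry
    of \<open>D\<close> at \<open>i\<close>, the sign carried by the product of the two
    \<open>T\<close> terms.\<close>
  also have "\<dots> = (\<Sum>i=1..n. (-1) ^ (i - 1) * s i (x i) (y i))
      + (\<Sum>i\<in>{1..<n}. - ((-1) ^ i) * s i (T i (x (i + 1))) (T i (y (i + 1))))"
    unfolding sum.distrib sum_if_less_left by simp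
  finally have "(\<Sum>i=1..n. (-1) ^ (i - 1) * (s i (x i) (y i)
      - (if 1 < i then s (i - 1) (T (i - 1) (x i)) (T (i - 1) (y i)) else 0)))
      + (\<Sum>i\<in>{1..<n}. s i (x i) (T i (y (i + 1))) + s i (T i (x (i + 1))) (y i))
    = (\<Sum>i=1..n. (-1) ^ (i - 1) * s i (x i) (y i))
      + (\<Sum>i\<in>{1..<n}. - ((-1) ^ i) * s i (T i (x (i + 1))) (T i (y (i + 1)))
         + (s i (x i) (T i (y (i + 1))) + s i (T i (x (i + 1))) (y i)))"
    by (simp only: sum.distrib add.assoc)
  also have "\<dots> = (\<Sum>i=1..n. (-1) ^ (i - 1) * s i (x i) (y i)
      + (if i < n then - ((-1) ^ i) * s i (T i (x (i + 1))) (T i (y (i + 1)))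
         + (s i (x i) (T i (y (i + 1))) + s i (T i (x (i + 1))) (y i)) else 0))"
    unfolding sum.distrib[of "\<lambda>i. (-1) ^ (i - 1) * s i (x i) (y i)"] sum_if_less_right ..
  also have "\<dots> = (\<Sum>i=1..n. (-1) ^ (i - 1) * s i (zmap x i) (zmap y i))"
  proof (rule sum.cong)
    fix i assume i: "i \<in> {1..n}"
    obtain k where k: "i = Suc k" using i by (cases i) auto
    interpret hilbert_form "V (Suc k)" "s (Suc k)" using block[OF i] k by simp
    have "T i (x (i + 1)) \<in> V i" "T i (y (i + 1)) \<in> V i" if "i < n"
      using T[of i] W_mem[OF x, of "i + 1"] W_mem[OF y, of "i + 1"] that i by simp_all
    then show "(-1) ^ (i - 1) * s i (x i) (y i)
      + (if i < n then - ((-1) ^ i) * s i (T i (x (i + 1))) (T i (y (i + 1)))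
         + (s i (x i) (T i (y (i + 1))) + s i (T i (x (i + 1))) (y i)) else 0)
      = (-1) ^ (i - 1) * s i (zmap x i) (zmap y i)"
      using W_mem[OF x i] W_mem[OF y i] unfolding zmap_def k
      by (cases "even k") (simp_all add: form_simps)
  qed simp
  finally show ?thesis by (simp add: total_mmap[OF x y])
qed

lemma mmap_surj:
  assumes g: "g \<in> W"
  shows "\<exists>x\<in>W. mmap x = g"
proof -
  \<comment> \<open>Forward substitution for \<open>L z = g\<close>; the guard \<open>0 < k\<close>
    keeps the dummy index \<open>0\<close> out of the first block.\<close>
  define z where "z = rec_nat 0 (\<lambda>k zk. g (Suc k) - (if 0 < k then (-1) ^ Suc k *\<^sub>R G k zk else 0))"
  have z_Suc: "z (Suc k) = g (Suc k) - (if 0 < k then (-1) ^ Suc k *\<^sub>R G k (z k) else 0)" for k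
    by (simp add: z_def)
  have z: "z i \<in> V i" if "1 \<le> i" "i \<le> n" for i
    using that
  proof (induction i)
    case (Suc k)
    interpret hilbert_form "V (Suc k)" "s (Suc k)" using block Suc.prems by simp
    have "G k (z k) \<in> V (Suc k)" if "0 < k" using G[of k "z k"] Suc that by simp
    moreover have "g (Suc k) \<in> V (Suc k)" using W_mem[OF g] Suc.prems by simp
    ultimately show ?case unfolding z_Suc by (cases "even k"; cases "k = 0") auto
  qed simp
  have lz: "lmap z = g"
  proof
    fix i show "lmap z i = g i"
    proof (cases "i \<in> {1..n}")
      case True
      then obtain k where "i = Suc k" by (cases i) auto
      then show ?thesis using True z_Suc[of k] by (simp add: lmap_def)
    qed (use g in \<open>auto simp: lmap_def product_space_def\<close>)
  qed
  \<comment> \<open>Back substitution for \<open>D L\<^sup>* x = z\<close>, starting at the last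
    block: \<open>w k\<close> is the entry at index \<open>n - k\<close>.\<close>
  define w where "w = rec_nat ((-1) ^ (n - 1) *\<^sub>R z n)
    (\<lambda>k wk. (-1) ^ (n - Suc k - 1) *\<^sub>R (z (n - Suc k) - T (n - Suc k) wk))"
  have w_Suc: "w (Suc k) = (-1) ^ (n - Suc k - 1) *\<^sub>R (z (n - Suc k) - T (n - Suc k) (w k))" for k
    by (simp add: w_def)
  have w: "w k \<in> V (n - k)" if "k < n" for k
    using that
  proof (induction k)
    case 0
    interpret hilbert_form "V n" "s n" using block 0 by simp
    show ?case using z[of n] 0 by (simp add: w_def)
  next
    case (Suc k)
    then interpret hilbert_form "V (n - Suc k)" "s (n - Suc k)" using block by simp
    have "n - k = n - Suc k + 1" using Suc.prems by simp
    then have "T (n - Suc k) (w k) \<in> V (n - Suc k)"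
      using T[of "n - Suc k" "w k"] Suc by simp
    then show ?case using z[of "n - Suc k"] Suc.prems by (simp add: w_def)
  qed
  define x where "x = (\<lambda>i. if i \<in> {1..n} then w (n - i) else 0)"
  have x: "x \<in> W"
    unfolding x_def
  proof (rule W_I)
    show "w (n - i) \<in> V i" if "i \<in> {1..n}" for i
      using w[of "n - i"] that by simp
  qed
  have zx: "zmap x i = z i" if i: "i \<in> {1..n}" for i
  proof (cases "i < n")
    case True
    then have "n - i = Suc (n - (i + 1))" "n - Suc (n - (i + 1)) = i" by auto
    then have "w (n - i) = (-1) ^ (i - 1) *\<^sub>R (z i - T i (w (n - (i + 1))))"
      using w_Suc[of "n - (i + 1)"] by simp
    then have "x i = (-1) ^ (i - 1) *\<^sub>R (z i - T i (x (i + 1)))"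
      using i True by (simp add: x_def)
    then show ?thesis using True by (simp add: zmap_def flip: power_add mult_2)
  next
    case False
    then have "i = n" using i by simp
    then show ?thesis using i by (simp add: zmap_def x_def w_def flip: power_add mult_2)
  qed
  have "mmap x = lmap z"
    unfolding mmap_def lmap_def
  proof
    fix i
    show "(if i \<in> {1..n} then zmap x i + (if 1 < i then (-1) ^ i *\<^sub>R G (i - 1) (zmap x (i - 1)) else 0) else 0) =
      (if i \<in> {1..n} then z i + (if 1 < i then (-1) ^ i *\<^sub>R G (i - 1) (z (i - 1)) else 0) else 0)"
    proof (cases "i \<in> {1..n} \<and> 1 < i")
      case True
      then have "i - 1 \<in> {1..n}" by auto
      then show ?thesis using zx[of i] zx[of "i - 1"] True by simp
    qed (use zx[of i] in auto)
  qed
  then show ?thesis using x lz by auto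
qed

section \<open>The condition number of a block chain\<close>

lemma condition_number_chain:
  assumes AA: "\<And>x. x \<in> W \<Longrightarrow> AA x = total (mmap x)"
  defines "N \<equiv> \<lambda>x. sqrt (total x x)" and "MM \<equiv> inv_into W total \<circ> AA"
  shows "isomorphism_on W N (dual W N) (dual_norm W N) AA"
    and "isomorphism_on W N W N MM"
    and "condition_number W N (dual W N) (dual_norm W N) AA = condition_number W N W N MM"
    and "condition_number W N W N MM \<le> cos (pi / (2 * n + 1)) / sin (pi / (2 * (2 * n + 1)))"
proof -
  define lam where "lam = 2 * cos (pi / (2 * n + 1))"
  define mu where "mu = 2 * sin (pi / (2 * n + 1) / 2)"
  interpret tot: hilbert_form W total by (fact total_form)
  have th: "0 < pi / (2 * n + 1)" by simp
  \<comment> \<open>The angle stays below \<open>pi / 2\<close> because \<open>n\<close> is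
    positive, which makes \<open>lam\<close> positive.\<close>
  have th2: "pi / (2 * n + 1) < pi / 2"
    using n by (intro divide_strict_left_mono) auto
  have lam: "0 < lam" unfolding lam_def using cos_gt_zero[OF th th2] by simp
  have "a / 2 < pi" if "a < pi / 2" for a :: real using that pi_gt_zero by linarith
  from this[OF th2]
  have mu: "0 < mu" unfolding mu_def using sin_gt_zero[of "pi / (2 * n + 1) / 2"] th by simp
  have symM: "total (mmap x) y = total x (mmap y)" if "x \<in> W" "y \<in> W" for x y
  proof -
    have "total (mmap x) y = total (mmap y) x"
      unfolding total_mmap[OF that] total_mmap[OF that(2,1)]
      by (rule sum.cong) (auto intro!: hilbert_form.sym[OF block] zmap_mem that)
    then show ?thesis using tot.sym that mmap_mem by simp
  qed
  have upper: "\<bar>total (mmap x) x\<bar> \<le> lam * total x x" if x: "x \<in> W" for x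
  proof -
    have "(\<Sum>i\<in>{1..<n}. s i (x i) (T i (x (i + 1))) + s i (T i (x (i + 1))) (x i))
      = 2 * (\<Sum>i\<in>{1..<n}. s i (x i) (T i (x (i + 1))))"
      unfolding sum_distrib_left
    proof (rule sum.cong)
      fix i assume i: "i \<in> {1..<n}"
      then interpret hilbert_form "V i" "s i" using block by simp
      have "x i \<in> V i" "T i (x (i + 1)) \<in> V i" using i T[of i] W_mem[OF x] by auto
      from sym[OF this]
      show "s i (x i) (T i (x (i + 1))) + s i (T i (x (i + 1))) (x i) = 2 * s i (x i) (T i (x (i + 1)))"
        by simp
    qed simp
    then show ?thesis
      using upper_bound[of x] W_mem[OF x] x
      by (simp add: total_mmap_expand lam_def) (simp add: total_def)
  qed
  have lower: "mu * \<bar>total (mmap x) x\<bar> \<le> total (mmap x) (mmap x)" if x: "x \<in> W" for x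
  proof -
    have "total (mmap x) (mmap x) = (\<Sum>i=1..n. s i (lmap (zmap x) i) (lmap (zmap x) i))"
      using mmap_mem[OF x] by (simp add: total_def mmap_def)
    also have "\<dots> = (\<Sum>i=1..n.
        s i (zmap x i + (if 1 < i then (-1) ^ i *\<^sub>R G (i - 1) (zmap x (i - 1)) else 0))
            (zmap x i + (if 1 < i then (-1) ^ i *\<^sub>R G (i - 1) (zmap x (i - 1)) else 0)))"
      by (rule sum.cong) (auto simp: lmap_def)
    finally show ?thesis
      using lower_bound[of "zmap x"] zmap_mem[OF x] unfolding total_mmap[OF x x] mu_def by simp
  qed
  note main = tot.preconditioned_operator[of mmap lam mu AA, OF mmap_mem symM mmap_surj upper lower lam mu AA,
    folded N_def MM_def]
  show "isomorphism_on W N (dual W N) (dual_norm W N) AA" "isomorphism_on W N W N MM"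
    "condition_number W N (dual W N) (dual_norm W N) AA = condition_number W N W N MM"
    by (rule main; assumption)+
  have "condition_number W N W N MM \<le> lam / mu" by (rule main)
  also have "lam / mu = cos (pi / (2 * n + 1)) / sin (pi / (2 * (2 * n + 1)))"
    by (simp add: lam_def mu_def mult.commute)
  finally show "condition_number W N W N MM \<le> cos (pi / (2 * n + 1)) / sin (pi / (2 * (2 * n + 1)))" .
qed

end

subsection \<open>Coercive forms and the Riesz representation\<close>

lemma dual_bound:
  assumes f: "f \<in> dual V norm" and y: "y \<in> V"
  shows "\<bar>f y\<bar> \<le> dual_norm V norm f * norm y"
proof -
  obtain C where C: "\<And>x. x \<in> V \<Longrightarrow> \<bar>f x\<bar> \<le> C * norm x"
    using f unfolding dual_def bounded_linear_on_def mem_Collect_eq by blast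
  show ?thesis
  proof (cases "y = 0")
    case True
    then show ?thesis using C[OF y] by simp
  next
    case False
    \<comment> \<open>\<open>C\<close> may be negative on the zero space, hence its absolute
      value.\<close>
    have "\<bar>f x\<bar> / norm x \<le> \<bar>C\<bar>" if "x \<in> V" for x
      using order_trans[OF C[OF that] mult_right_mono[OF abs_ge_self norm_ge_zero]]
      by (cases "x = 0") (auto simp: divide_le_eq)
    then have "bdd_above ((\<lambda>x. \<bar>f x\<bar> / norm x) ` V)" by (auto simp: bdd_above_def)
    then have "\<bar>f y\<bar> / norm y \<le> dual_norm V norm f"
      unfolding dual_norm_def op_norm_def using y by (rule cSUP_upper2) simp
    then show ?thesis using False by (simp add: divide_le_eq)
  qed
qed

text \<open>A bounded operator into the dual, seen as a bounded bilinear form: the estimate in both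
  arguments avoids the dual norm, and \<open>0 \<le> C\<close> lets estimates be chained.\<close>

definition bounded_form :: "'v::real_normed_vector set \<Rightarrow> 'w::real_normed_vector set \<Rightarrow> ('v \<Rightarrow> 'w \<Rightarrow> real) \<Rightarrow> bool"
  where "bounded_form V W T \<longleftrightarrow>
    (\<forall>x\<in>V. T x \<in> dual W norm) \<and>
    (\<forall>x\<in>V. \<forall>y\<in>V. T (x + y) = T x + T y) \<and>
    (\<forall>c. \<forall>x\<in>V. T (c *\<^sub>R x) = c *\<^sub>R T x) \<and>
    (\<exists>C\<ge>0. \<forall>x\<in>V. \<forall>y\<in>W. \<bar>T x y\<bar> \<le> C * norm x * norm y)"

lemma bounded_form_of_bounded_linear:
  assumes T: "bounded_linear_on V norm (dual W norm) (dual_norm W norm) T"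
  shows "bounded_form V W T"
proof -
  obtain C where C: "\<And>x. x \<in> V \<Longrightarrow> dual_norm W norm (T x) \<le> C * norm x"
    using T unfolding bounded_linear_on_def by blast
  have D: "T x \<in> dual W norm" if "x \<in> V" for x
    using T that unfolding bounded_linear_on_def by blast
  have "\<bar>T x y\<bar> \<le> \<bar>C\<bar> * norm x * norm y" if "x \<in> V" "y \<in> W" for x y
  proof -
    have "\<bar>T x y\<bar> \<le> dual_norm W norm (T x) * norm y" using dual_bound[OF D] that by blast
    also have "\<dots> \<le> (C * norm x) * norm y" using C that by (intro mult_right_mono) auto
    also have "\<dots> \<le> \<bar>C\<bar> * norm x * norm y" by (intro mult_right_mono) auto
    finally show ?thesis .
  qed
  then show ?thesis
    using T D unfolding bounded_form_def bounded_linear_on_def by (metis abs_ge_zero)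
qed

lemma bounded_formD:
  assumes "bounded_form V W T"
  shows "x \<in> V \<Longrightarrow> T x \<in> dual W norm"
    and "x \<in> V \<Longrightarrow> x' \<in> V \<Longrightarrow> T (x + x') y = T x y + T x' y"
    and "x \<in> V \<Longrightarrow> T (c *\<^sub>R x) y = c * T x y"
    and "x \<in> V \<Longrightarrow> y \<in> W \<Longrightarrow> y' \<in> W \<Longrightarrow> T x (y + y') = T x y + T x y'"
    and "x \<in> V \<Longrightarrow> y \<in> W \<Longrightarrow> T x (c *\<^sub>R y) = c * T x y"
    and "x \<in> V \<Longrightarrow> y \<notin> W \<Longrightarrow> T x y = 0"
  using assms by (auto simp: bounded_form_def dual_def bounded_linear_on_def scaleR_fun_def)

lemma bounded_form_bound:
  assumes "bounded_form V W T"
  obtains C where "0 \<le> C" "\<And>x y. x \<in> V \<Longrightarrow> y \<in> W \<Longrightarrow> \<bar>T x y\<bar> \<le> C * norm x * norm y"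
  using assms by (auto simp: bounded_form_def)

lemma dual_cong_norm:
  assumes "\<And>x. x \<in> V \<Longrightarrow> N x \<le> a * M x" "\<And>x. x \<in> V \<Longrightarrow> M x \<le> b * N x"
    and "\<And>x. x \<in> V \<Longrightarrow> 0 \<le> N x" "\<And>x. x \<in> V \<Longrightarrow> 0 \<le> M x"
  shows "dual V N = dual V M"
proof -
  \<comment> \<open>The norms are quantified here so that exchanging them gives the reverse
    inclusion.\<close>
  have "\<exists>D. \<forall>x\<in>V. \<bar>f x\<bar> \<le> D * M x"
    if C: "\<forall>x\<in>V. \<bar>f x\<bar> \<le> C * N x" and NM: "\<forall>x\<in>V. N x \<le> a * M x" and nn: "\<forall>x\<in>V. 0 \<le> N x"
    for f :: "'a \<Rightarrow> real" and C a :: real and N M :: "'a \<Rightarrow> real"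
  proof (intro exI ballI)
    fix x assume x: "x \<in> V"
    have "\<bar>f x\<bar> \<le> C * N x" using C x by blast
    also have "\<dots> \<le> \<bar>C\<bar> * N x" using nn x by (intro mult_right_mono) auto
    also have "\<dots> \<le> \<bar>C\<bar> * (a * M x)" using NM x by (intro mult_left_mono) auto
    finally show "\<bar>f x\<bar> \<le> (\<bar>C\<bar> * a) * M x" by simp
  qed
  from this[of _ _ N a M] this[of _ _ M b N] show ?thesis
    using assms unfolding dual_def bounded_linear_on_def by blast
qed

text \<open>Direct method of the calculus of variations: minimise \<open>s x x - 2 * f x\<close>.
  Coercivity makes a minimising sequence Cauchy, and its limit satisfies the Euler equation
  \<open>s u v = f v\<close>.\<close>

lemma riesz_coercive:
  fixes V :: "'a::real_inner set"
  assumes V: "subspace V" "complete V"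
    and s: "bounded_form V V s"
    and sym: "\<And>x y. x \<in> V \<Longrightarrow> y \<in> V \<Longrightarrow> s x y = s y x"
    and sig: "0 < sig" "\<And>x. x \<in> V \<Longrightarrow> sig * (norm x)\<^sup>2 \<le> s x x"
    and f: "f \<in> dual V norm"
  shows "\<exists>u\<in>V. s u = f"
proof -
  note mem = subspace_add[OF V(1)] subspace_diff[OF V(1)] subspace_scale[OF V(1)]
  note lin = bounded_formD[OF s]
  have flin: "f (x + y) = f x + f y" "f (c *\<^sub>R x) = c * f x" if "x \<in> V" "y \<in> V" for x y c
    using f that by (auto simp: dual_def bounded_linear_on_def)
  obtain K where K: "\<And>x y. x \<in> V \<Longrightarrow> y \<in> V \<Longrightarrow> \<bar>s x y\<bar> \<le> K * norm x * norm y"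
    using bounded_form_bound[OF s] by blast
  define C where "C = dual_norm V norm f"
  have C: "\<bar>f x\<bar> \<le> C * norm x" if "x \<in> V" for x using dual_bound[OF f that] by (simp add: C_def)
  have s_nonneg: "0 \<le> s x x" if "x \<in> V" for x
    using order_trans[OF mult_nonneg_nonneg[OF less_imp_le[OF sig(1)] zero_le_power2] sig(2)[OF that]] .
  define J where "J x = s x x - 2 * f x" for x
  have J_lower: "- (C\<^sup>2 / sig) \<le> J x" if "x \<in> V" for x
  proof -
    have "0 \<le> (sig * norm x - C)\<^sup>2 / sig" using sig(1) by simp
    also have "\<dots> = sig * (norm x)\<^sup>2 - 2 * C * norm x + C\<^sup>2 / sig"
      using sig(1) by (simp add: power2_eq_square field_simps)
    also have "\<dots> \<le> J x + C\<^sup>2 / sig"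
      using sig(2)[OF that] C[OF that] by (simp add: J_def abs_le_iff)
    finally show ?thesis by simp
  qed
  define m where "m = Inf (J ` V)"
  have bdd: "bdd_below (J ` V)" using J_lower by (auto simp: bdd_below_def)
  have mJ: "m \<le> J x" if "x \<in> V" for x unfolding m_def using bdd that by (rule cINF_lower)
  have "\<exists>x\<in>V. J x < m + 1 / real (Suc k)" for k
  proof -
    have "\<exists>y\<in>J ` V. y < m + 1 / real (Suc k)"
      using subspace_0[OF V(1)] by (intro cInf_lessD) (auto simp: m_def)
    then show ?thesis by blast
  qed
  then obtain x where x: "\<And>k. x k \<in> V" and Jx: "\<And>k. J (x k) < m + 1 / real (Suc k)" by metis
  \<comment> \<open>Parallelogram identity with the midpoint \<open>c\<close>, which lies in
    \<open>V\<close> and therefore has \<open>J c\<close> at least \<open>m\<close>.\<close>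
  have para: "sig * (norm (a - b))\<^sup>2 \<le> 2 * J a + 2 * J b - 4 * m" if a: "a \<in> V" and b: "b \<in> V" for a b
  proof -
    define c where "c = (1/2) *\<^sub>R (a + b)"
    have c: "c \<in> V" using a b mem by (simp add: c_def)
    have d: "a - b = a + (-1) *\<^sub>R b" by simp
    have "s (a - b) (a - b) = s a a - 2 * s a b + s b b"
      unfolding d using a b mem sym[of a b] by (simp add: lin mem del: scaleR_minus_left scaleR_minus1_left)
    moreover have "4 * s c c = s a a + 2 * s a b + s b b"
      using a b mem sym[of a b] by (simp add: c_def lin add_divide_distrib)
    moreover have "2 * f c = f a + f b" using a b mem by (simp add: c_def flin)
    ultimately have "s (a - b) (a - b) = 2 * J a + 2 * J b - 4 * J c" by (simp add: J_def)
    then show ?thesis using sig(2)[of "a - b"] mem a b mJ[OF c] by fastforce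
  qed
  have "Cauchy x"
  proof (rule metric_CauchyI)
    fix e :: real assume e: "0 < e"
    obtain M :: nat where M: "4 / (sig * e\<^sup>2) < real M" using reals_Archimedean2 by blast
    have small: "1 / real (Suc k) < sig * e\<^sup>2 / 4" if "M \<le> k" for k
    proof -
      have "4 / (sig * e\<^sup>2) < real (Suc k)" using M that by linarith
      then show ?thesis using sig(1) e by (simp add: field_simps)
    qed
    show "\<exists>M. \<forall>k\<ge>M. \<forall>l\<ge>M. dist (x k) (x l) < e"
    proof (intro exI allI impI)
      fix k l assume "M \<le> k" "M \<le> l"
      then have "sig * (norm (x k - x l))\<^sup>2 < sig * e\<^sup>2"
        using para[OF x x, of k l] Jx[of k] Jx[of l] small[of k] small[of l] by linarith
      then have "(norm (x k - x l))\<^sup>2 < e\<^sup>2" using sig(1) by simp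
      then show "dist (x k) (x l) < e" using e by (simp add: dist_norm power_less_imp_less_base)
    qed
  qed
  then obtain u where u: "u \<in> V" and lim: "x \<longlonglongrightarrow> u"
    using V(2) x unfolding complete_def by blast
  have main: "s u v = f v" if v: "v \<in> V" for v
  proof -
    have le: "norm (s (x k) v - s u v) \<le> K * norm v * norm (x k - u)" for k
    proof -
      have "s (x k) v = s (x k - u) v + s u v" using lin(2)[of "x k - u" u] x u mem by simp
      then show ?thesis using K[of "x k - u" v] x u v mem by (simp add: mult_ac)
    qed
    have "(\<lambda>k. K * norm v * norm (x k - u)) \<longlonglongrightarrow> 0"
      using tendsto_mult_left[OF tendsto_norm_zero[OF LIM_zero[OF lim]], of "K * norm v"] by simp
    then have "(\<lambda>k. s (x k) v - s u v) \<longlonglongrightarrow> 0"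
      by (rule Lim_null_comparison[OF always_eventually[OF allI[OF le]]])
    then have sl: "(\<lambda>k. s (x k) v) \<longlonglongrightarrow> s u v" by (rule LIM_zero_cancel)
    define d where "d = f v - s u v"
    \<comment> \<open>First variation in direction \<open>t *\<^sub>R v\<close>, taken at
      \<open>x k\<close> and passed to the limit.\<close>
    have key: "2 * t * d \<le> t\<^sup>2 * s v v" for t
    proof -
      have "2 * t * (f v - s (x k) v) \<le> t\<^sup>2 * s v v + 1 / real (Suc k)" for k
      proof -
        have "J (x k + t *\<^sub>R v) = J (x k) + 2 * t * (s (x k) v - f v) + t\<^sup>2 * s v v"
          using x[of k] v mem sym[of v "x k"]
          by (simp add: J_def lin flin power2_eq_square algebra_simps)
        then show ?thesis using mJ[of "x k + t *\<^sub>R v"] Jx[of k] x v mem by (simp add: algebra_simps)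
      qed
      moreover have "(\<lambda>k. 2 * t * (f v - s (x k) v)) \<longlonglongrightarrow> 2 * t * d"
        unfolding d_def by (intro tendsto_intros sl)
      moreover have "(\<lambda>k. t\<^sup>2 * s v v + 1 / real (Suc k)) \<longlonglongrightarrow> t\<^sup>2 * s v v + 0"
        using LIMSEQ_inverse_real_of_nat by (intro tendsto_intros) (simp add: inverse_eq_divide)
      ultimately show ?thesis using LIMSEQ_le by fastforce
    qed
    \<comment> \<open>The summand \<open>1\<close> keeps \<open>c\<close> positive even for
      \<open>v = 0\<close>; the test value \<open>t = d / c\<close> then forces
      \<open>d = 0\<close>.\<close>
    define c where "c = s v v + 1"
    have c: "0 < c" using s_nonneg[OF v] by (simp add: c_def)
    have "2 * d\<^sup>2 / c \<le> d\<^sup>2 / c\<^sup>2 * (c - 1)"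
      using key[of "d / c"] by (simp add: c_def power2_eq_square)
    then have "2 * d\<^sup>2 * c \<le> d\<^sup>2 * (c - 1)" using c by (simp add: field_simps power2_eq_square)
    then have "d\<^sup>2 * (c + 1) \<le> 0" by (simp add: algebra_simps)
    then have "d = 0" using c by (simp add: mult_le_0_iff)
    then show ?thesis by (simp add: d_def)
  qed
  have "s u v = f v" for v
    using main lin(6)[OF u, of v] f by (cases "v \<in> V") (auto simp: dual_def)
  then show ?thesis using u by blast
qed

text \<open>Boundedness and coercivity make the energy norm equivalent to the original norm, so the
  same functionals are bounded.\<close>

lemma coercive_dual_eq:
  assumes s: "bounded_form V V s" and "pos_def_on V norm s"
  shows "dual V (\<lambda>x. sqrt (s x x)) = dual V norm"
proof -
  obtain sig where sig: "0 < sig" "\<And>x. x \<in> V \<Longrightarrow> sig * (norm x)\<^sup>2 \<le> s x x"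
    using assms(2) by (auto simp: pos_def_on_def)
  obtain K where K: "0 \<le> K" "\<And>x y. x \<in> V \<Longrightarrow> y \<in> V \<Longrightarrow> \<bar>s x y\<bar> \<le> K * norm x * norm y"
    using bounded_form_bound[OF s] by blast
  show ?thesis
  proof (rule dual_cong_norm[where a = "sqrt K" and b = "1 / sqrt sig"])
    fix x assume x: "x \<in> V"
    have "sqrt (s x x) \<le> sqrt (K * (norm x)\<^sup>2)"
      using K(2)[OF x x] by (simp add: power2_eq_square mult.assoc)
    then show "sqrt (s x x) \<le> sqrt K * norm x" by (simp add: real_sqrt_mult)
    have "sqrt (sig * (norm x)\<^sup>2) \<le> sqrt (s x x)" using sig(2)[OF x] by simp
    then show "norm x \<le> 1 / sqrt sig * sqrt (s x x)"
      using sig(1) by (simp add: real_sqrt_mult field_simps)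
    have "0 \<le> sig * (norm x)\<^sup>2" using sig(1) by simp
    then show "0 \<le> sqrt (s x x)" using sig(2)[OF x] by simp
  qed simp
qed

lemma coercive_hilbert_form:
  fixes V :: "'a::real_inner set"
  assumes V: "subspace V" "complete V"
    and s: "bounded_form V V s" "self_adjoint_on V s" "pos_def_on V norm s"
  shows "hilbert_form V s"
proof
  note lin = bounded_formD[OF s(1)]
  obtain sig where sig: "0 < sig" "\<And>x. x \<in> V \<Longrightarrow> sig * (norm x)\<^sup>2 \<le> s x x"
    using s(3) by (auto simp: pos_def_on_def)
  have sym: "s x y = s y x" if "x \<in> V" "y \<in> V" for x y
    using s(2) that by (simp add: self_adjoint_on_def)
  show "subspace V" by fact
  show "s (x + y) z = s x z + s y z" if "x \<in> V" "y \<in> V" for x y z using lin(2) that .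
  show "s (c *\<^sub>R x) z = c * s x z" if "x \<in> V" for x z c using lin(3) that .
  show "s x y = s y x" if "x \<in> V" "y \<in> V" for x y using sym that .
  show "0 < s x x" if "x \<in> V" "x \<noteq> 0" for x
    using sig(2)[OF that(1)] mult_pos_pos[OF sig(1), of "(norm x)\<^sup>2"] that(2) by simp
  show "s x y = 0" if "x \<in> V" "y \<notin> V" for x y using lin(6) that .
  show "\<exists>u\<in>V. s u = f" if "f \<in> dual V (\<lambda>x. sqrt (s x x))" for f
    using riesz_coercive[OF V s(1) sym sig] that coercive_dual_eq[OF s(1,3)] by blast
qed

subsection \<open>Schur complement preconditioning\<close>

theorem corollary2p1:
  fixes n :: nat
    and X :: "nat \<Rightarrow> 'a::real_inner set"
    and A B :: "nat \<Rightarrow> 'a \<Rightarrow> 'a \<Rightarrow> real"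
  assumes n: "n \<ge> 2"
    and hilbert: "\<And>i. i \<in> {1..n} \<Longrightarrow> subspace (X i) \<and> complete (X i)"
    and A_bounded: "\<And>i. i \<in> {1..n} \<Longrightarrow>
      bounded_linear_on (X i) norm (dual (X i) norm) (dual_norm (X i) norm) (A i)"
    and A_self_adjoint: "\<And>i. i \<in> {1..n} \<Longrightarrow> self_adjoint_on (X i) (A i)"
    and A_pos_semidef: "\<And>i. i \<in> {1..n} \<Longrightarrow> pos_semidef_on (X i) (A i)"
    and B_bounded: "\<And>i. i \<in> {1..n-1} \<Longrightarrow>
      bounded_linear_on (X i) norm (dual (X (i+1)) norm) (dual_norm (X (i+1)) norm) (B i)"
    and S_pos_def: "\<And>i. i \<in> {1..n} \<Longrightarrow> pos_def_on (X i) norm (schur X A B i)"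
  shows "let XX = product_space n X;
             N = schur_norm n X A B;
             XX' = dual XX N;
             N' = dual_norm XX N;
             AA = tridiag_op n X A B;
             MM = precond_op n X A B
         in isomorphism_on XX N XX' N' AA
          \<and> isomorphism_on XX N XX N MM
          \<and> condition_number XX N XX' N' AA = condition_number XX N XX N MM
          \<and> condition_number XX N XX N MM \<le> cos (pi / (2 * n + 1)) / sin (pi / (2 * (2 * n + 1)))"
proof -
  define s where "s = schur X A B"
  define T where "T i y = inv_into (X i) (s i) (adj (X i) (B i) y)" for i y
  have bA: "bounded_form (X i) (X i) (A i)" if "i \<in> {1..n}" for i
    using bounded_form_of_bounded_linear[OF A_bounded[OF that]] .
  have bB: "bounded_form (X i) (X (i + 1)) (B i)" if "i \<in> {1..<n}" for i
  proof (rule bounded_form_of_bounded_linear[OF B_bounded])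
    show "i \<in> {1..n - 1}" using that by auto
  qed
  have s1: "s 1 = A 1" by (simp add: s_def)
  have s_Suc: "s (i + 1) y = A (i + 1) y + B i (T i y)" if "1 \<le> i" for i y
    using that by (cases i) (simp_all add: s_def T_def)
  \<comment> \<open>Induction invariant: \<open>s (i + 1)\<close> is built from \<open>T i\<close>,
    which is meaningful only once \<open>s i\<close> is a Hilbert form. Coercivity is a hypothesis,
    so \<open>okI\<close> needs boundedness and symmetry only.\<close>
  define ok where "ok i \<longleftrightarrow> hilbert_form (X i) (s i) \<and> bounded_form (X i) (X i) (s i)" for i
  have okI: "ok i" if "i \<in> {1..n}" "bounded_form (X i) (X i) (s i)" "self_adjoint_on (X i) (s i)" for i
    using coercive_hilbert_form[of "X i" "s i"] hilbert S_pos_def that unfolding ok_def s_def by blast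
  have T: "T i y \<in> X i \<and> (\<forall>x\<in>X i. s i (T i y) x = B i x y)"
    if i: "i \<in> {1..<n}" and ok: "ok i" and y: "y \<in> X (i + 1)" for i y
  proof -
    have i': "i \<in> {1..n}" using i by auto
    interpret hilbert_form "X i" "s i" using ok by (simp add: ok_def)
    note B = bounded_formD[OF bB[OF i]]
    obtain C where C: "\<And>x y. x \<in> X i \<Longrightarrow> y \<in> X (i + 1) \<Longrightarrow> \<bar>B i x y\<bar> \<le> C * norm x * norm y"
      using bounded_form_bound[OF bB[OF i]] by blast
    have "adj (X i) (B i) y \<in> dual (X i) norm"
      unfolding dual_def bounded_linear_on_def
      using B C[OF _ y] by (auto simp: adj_def mult_ac intro!: exI[of _ "C * norm y"])
    \<comment> \<open>By Riesz \<open>B\<^sub>i' y\<close> lies in the range of \<open>s i\<close>,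
      so \<open>inv_into\<close> returns a true preimage.\<close>
    then have "adj (X i) (B i) y \<in> s i ` X i"
      using dual_eq coercive_dual_eq[of "X i" "s i"] ok S_pos_def[OF i'] by (simp add: ok_def s_def)
    then have "T i y \<in> X i" "s i (T i y) = adj (X i) (B i) y"
      unfolding T_def by (auto intro: inv_into_into f_inv_into_f)
    then show ?thesis by (simp add: adj_def)
  qed
  have ok: "ok i" if "1 \<le> i" "i \<le> n" for i
    using that
  proof (induction i rule: nat_induct_at_least)
    case base
    then show ?case using bA[of 1] A_self_adjoint[of 1] by (intro okI) (simp_all add: s1[simplified])
  next
    case (Suc i)
    then have i: "i \<in> {1..<n}" "i \<in> {1..n}" "Suc i \<in> {1..n}" and oki: "ok i" by auto
    interpret hilbert_form "X i" "s i" using oki by (simp add: ok_def)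
    note B = bounded_formD[OF bB[OF i(1)], simplified]
    note A = bounded_formD[OF bA[OF i(3)]]
    note Ti = T[OF i(1) oki, simplified]
    note sub = subspace_add[OF conjunct1[OF hilbert[OF i(3)]]] subspace_scale[OF conjunct1[OF hilbert[OF i(3)]]]
    have Tadd: "T i (x + y) = T i x + T i y" if "x \<in> X (Suc i)" "y \<in> X (Suc i)" for x y
      by (rule eqI) (use that Ti sub B in \<open>auto simp: add_left\<close>)
    have Tscale: "T i (c *\<^sub>R x) = c *\<^sub>R T i x" if "x \<in> X (Suc i)" for x c
      by (rule eqI) (use that Ti sub B in \<open>auto simp: scale_left\<close>)
    obtain C where C: "0 \<le> C" "\<And>x y. x \<in> X i \<Longrightarrow> y \<in> X (Suc i) \<Longrightarrow> \<bar>B i x y\<bar> \<le> C * norm x * norm y"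
      using bounded_form_bound[OF bB[OF i(1)]] by auto
    obtain D where D: "0 \<le> D" "\<And>x y. x \<in> X (Suc i) \<Longrightarrow> y \<in> X (Suc i) \<Longrightarrow> \<bar>A (Suc i) x y\<bar> \<le> D * norm x * norm y"
      using bounded_form_bound[OF bA[OF i(3)]] by auto
    obtain sig where sig: "0 < sig" "\<And>x. x \<in> X i \<Longrightarrow> sig * (norm x)\<^sup>2 \<le> s i x x"
      using S_pos_def[OF i(2)] by (auto simp: pos_def_on_def s_def)
    have Tb: "norm (T i y) \<le> C / sig * norm y" if y: "y \<in> X (Suc i)" for y
    proof (cases "T i y = 0")
      case False
      \<comment> \<open>Coercivity tested with \<open>T i y\<close> itself, where
        \<open>s i (T i y) (T i y) = B i (T i y) y\<close>.\<close>
      have "sig * (norm (T i y))\<^sup>2 \<le> C * norm (T i y) * norm y"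
        using sig(2)[of "T i y"] C(2)[of "T i y" y] Ti[OF y] y by (simp add: abs_le_iff)
      then show ?thesis using False sig(1) by (simp add: power2_eq_square field_simps)
    qed (use C sig in simp)
    have sS: "s (Suc i) y = A (Suc i) y + B i (T i y)" for y using s_Suc[of i] i by simp
    define E where "E = D + C * (C / sig)"
    have E: "\<bar>s (Suc i) x y\<bar> \<le> E * norm x * norm y" if xy: "x \<in> X (Suc i)" "y \<in> X (Suc i)" for x y
    proof -
      have "\<bar>B i (T i x) y\<bar> \<le> C * norm (T i x) * norm y" using C(2) Ti xy by blast
      also have "\<dots> \<le> C * (C / sig * norm x) * norm y"
        using Tb[OF xy(1)] C(1) by (intro mult_right_mono mult_left_mono) auto
      finally show ?thesis using D(2)[OF xy] by (simp add: sS E_def algebra_simps)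
    qed
    show ?case
    proof (rule okI[OF i(3)])
      have "s (Suc i) x \<in> dual (X (Suc i)) norm" if x: "x \<in> X (Suc i)" for x
      proof -
        have "s (Suc i) x (y + z) = s (Suc i) x y + s (Suc i) x z" if "y \<in> X (Suc i)" "z \<in> X (Suc i)" for y z
          using A(4)[OF x that] B(4)[OF conjunct1[OF Ti[OF x]] that] by (simp add: sS)
        moreover have "s (Suc i) x (c *\<^sub>R y) = c * s (Suc i) x y" if "y \<in> X (Suc i)" for y c
          using A(5)[OF x that] B(5)[OF conjunct1[OF Ti[OF x]] that] by (simp add: sS distrib_left)
        moreover have "s (Suc i) x y = 0" if "y \<notin> X (Suc i)" for y
          using A(6)[OF x that] B(6)[OF conjunct1[OF Ti[OF x]] that] by (simp add: sS)
        moreover have "\<exists>C. \<forall>y\<in>X (Suc i). \<bar>s (Suc i) x y\<bar> \<le> C * norm y"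
          using E[OF x] by blast
        ultimately show ?thesis
          unfolding dual_def bounded_linear_on_def by simp
      qed
      moreover have "0 \<le> E" using C(1) D(1) sig(1) by (simp add: E_def)
      moreover have "s (Suc i) (x + y) = s (Suc i) x + s (Suc i) y"
        if "x \<in> X (Suc i)" "y \<in> X (Suc i)" for x y
        using A(2)[OF that] B(2)[of "T i x" "T i y"] Ti that by (simp add: sS Tadd fun_eq_iff)
      moreover have "s (Suc i) (c *\<^sub>R x) = c *\<^sub>R s (Suc i) x" if "x \<in> X (Suc i)" for x c
        using A(3)[OF that] B(3)[of "T i x"] Ti that
        by (simp add: sS Tscale fun_eq_iff scaleR_fun_def distrib_left)
      ultimately show "bounded_form (X (Suc i)) (X (Suc i)) (s (Suc i))"
        using E unfolding bounded_form_def by blast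
      \<comment> \<open>Both sides are \<open>s i\<close> applied to \<open>T i x\<close> and
        \<open>T i y\<close>, so symmetry of \<open>s i\<close> passes to the new Schur
        complement.\<close>
      have "B i (T i x) y = B i (T i y) x" if "x \<in> X (Suc i)" "y \<in> X (Suc i)" for x y
        using Ti that sym by metis
      then show "self_adjoint_on (X (Suc i)) (s (Suc i))"
        using A_self_adjoint[OF i(3)] by (auto simp: self_adjoint_on_def sS)
    qed
  qed
  have hf: "hilbert_form (X i) (s i)" if "i \<in> {1..n}" for i using ok that by (simp add: ok_def)
  have Ti: "T i y \<in> X i" "\<And>x. x \<in> X i \<Longrightarrow> s i (T i y) x = B i x y"
    "\<And>x. x \<in> X i \<Longrightarrow> s i x (T i y) = B i x y"
    if "i \<in> {1..<n}" "y \<in> X (i + 1)" for i y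
    using T[OF that(1) ok that(2)] hilbert_form.sym[OF hf[of i]] that(1) by auto
  have sA: "A (i + 1) y y' = s (i + 1) y y' - s i (T i y) (T i y')"
    if "i \<in> {1..<n}" "y \<in> X (i + 1)" "y' \<in> X (i + 1)" for i y y'
    using s_Suc[of i y] Ti[OF that(1,3)] Ti[OF that(1,2)] that(1) by simp
  \<comment> \<open>The Riesz representative of \<open>B i x\<close> in the next block defines
    \<open>G i x\<close>.\<close>
  have "\<exists>u\<in>X (i + 1). s (i + 1) u = B i x" if i: "i \<in> {1..<n}" and x: "x \<in> X i" for i x
  proof -
    have i': "i + 1 \<in> {1..n}" using i by auto
    have "B i x \<in> dual (X (i + 1)) norm" using bounded_formD(1)[OF bB[OF i] x] .
    then show ?thesis
      using hilbert_form.riesz[OF hf[OF i']] coercive_dual_eq[of "X (i + 1)" "s (i + 1)"]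
        ok[of "i + 1"] S_pos_def[OF i'] i' by (simp add: ok_def s_def)
  qed
  then obtain G where G: "\<And>i x. i \<in> {1..<n} \<Longrightarrow> x \<in> X i \<Longrightarrow> G i x \<in> X (i + 1) \<and> s (i + 1) (G i x) = B i x"
    by metis
  interpret block_chain n X s T G
  proof (rule block_chain.intro)
    show "1 \<le> n" using n by simp
    show "s i (T i y) (T i y) \<le> s (i + 1) y y" if "i \<in> {1..<n}" "y \<in> X (i + 1)" for i y
    proof -
      have "0 \<le> A (i + 1) y y" using A_pos_semidef[of "i + 1"] that by (simp add: pos_semidef_on_def)
      then show ?thesis using sA[OF that that(2)] by simp
    qed
    show "s (i + 1) (G i x) y = s i x (T i y)" if "i \<in> {1..<n}" "x \<in> X i" "y \<in> X (i + 1)" for i x y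
      using G[OF that(1,2)] Ti(3)[OF that(1,3,2)] by simp
    show "hilbert_form (X i) (s i)" if "i \<in> {1..n}" for i using hf that .
    show "T i y \<in> X i" if "i \<in> {1..<n}" "y \<in> X (i + 1)" for i y using Ti(1) that .
    show "G i x \<in> X (i + 1)" if "i \<in> {1..<n}" "x \<in> X i" for i x using G that by blast
  qed
  have tot: "schur_op n X A B = total"
  proof (intro ext)
    fix x y :: "nat \<Rightarrow> 'a"
    have "(\<Sum>j=1..n. (if i = j then schur X A B i else 0) (x j) (y i)) = s i (x i) (y i)"
      if "i \<in> {1..n}" for i
    proof -
      have "(\<Sum>j=1..n. (if i = j then schur X A B i else 0) (x j) (y i)) =
        (\<Sum>j=1..n. if i = j then s i (x i) (y i) else 0)"
        by (rule sum.cong) (auto simp: s_def)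
      then show ?thesis using that by simp
    qed
    then show "schur_op n X A B x y = total x y"
      by (simp add: schur_op_def block_op_def total_def)
  qed
  \<comment> \<open>The tridiagonal form coincides with the expanded form of \<open>mmap\<close>,
    since \<open>A i\<close> is \<open>s i\<close> minus the square of \<open>T (i - 1)\<close>;
    this is the factorisation of the preconditioned operator.\<close>
  have AA: "tridiag_op n X A B x = total (mmap x)" if x: "x \<in> W" for x
  proof
    fix y
    show "tridiag_op n X A B x y = total (mmap x) y"
    proof (cases "y \<in> W")
      case y: True
      have diag: "A i (x i) (y i) = s i (x i) (y i)
          - (if 1 < i then s (i - 1) (T (i - 1) (x i)) (T (i - 1) (y i)) else 0)" if i: "i \<in> {1..n}" for i
      proof (cases "1 < i")
        case True
        then obtain k where "i = Suc k" "1 \<le> k" by (cases i) auto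
        then show ?thesis using sA[of k "x i" "y i"] W_mem[OF x i] W_mem[OF y i] i by simp
      next
        case False
        then have "i = 1" using i by simp
        then show ?thesis using s1 by simp
      qed
      have "tridiag_op n X A B x y = (\<Sum>i=1..n. (-1) ^ (i - 1) * A i (x i) (y i))
          + (\<Sum>i\<in>{1..<n}. adj (X i) (B i) (x (i + 1)) (y i) + B i (x i) (y (i + 1)))"
        unfolding tridiag_op_def block_op_def if_P[OF y]
        by (subst sum_tridiag) (auto simp: scaleR_fun_def)
      also have "(\<Sum>i=1..n. (-1) ^ (i - 1) * A i (x i) (y i)) =
        (\<Sum>i=1..n. (-1) ^ (i - 1) * (s i (x i) (y i)
          - (if 1 < i then s (i - 1) (T (i - 1) (x i)) (T (i - 1) (y i)) else 0)))"
        by (rule sum.cong) (simp_all only: diag)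
      also have "(\<Sum>i\<in>{1..<n}. adj (X i) (B i) (x (i + 1)) (y i) + B i (x i) (y (i + 1)))
        = (\<Sum>i\<in>{1..<n}. s i (x i) (T i (y (i + 1))) + s i (T i (x (i + 1))) (y i))"
        by (rule sum.cong) (auto simp: adj_def Ti W_mem[OF x] W_mem[OF y])
      finally show ?thesis using total_mmap_expand[OF x y] by simp
    qed (simp add: tridiag_op_def block_op_def total_def)
  qed
  have N: "schur_norm n X A B = (\<lambda>x. sqrt (total x x))"
    by (simp add: schur_norm_def tot fun_eq_iff)
  show ?thesis
    unfolding Let_def N precond_op_def tot using condition_number_chain[OF AA] by blast
qed

end
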